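(* Let $\bar\nu_0=n-\bar\nu_1-\cdots-\bar\nu_p$. Problem 3C (stated in the context) is solvable if and only if $$\dim\Big(\mathcal V^\star_g+\sum_{i\in P}\mathcal V^\star_{g,i}\Big)\ge\sum_{i\in P}\bar\nu_i+\bar\nu_0$$ for all $P$ in the power set $2^I$, where $I=\{1,2,\ldots,p\}$.
   Context: System: $\Sigma=(A,B,C,D)$ is $\mathcal D x=Ax+Bu$, $y=Cx+Du$, $x(t)\in\mathbb R^n$, $u(t)\in\mathbb R^m$, $y(t)\in\mathbb R^p$, real matrices; $\mathcal D x=\dot x$ (continuous time) or $x(t+1)$ (discrete time). $\mathbb C_g$ is the open left half-plane (continuous) or open unit disc (discrete). Invariant zeros of $\Sigma$ are those $\lambda\in\mathbb C$ at which the rank of $\begin{bmatrix}A-\lambda I&B\\C&D\end{bmatrix}$ is below its normal rank; minimum-phase zeros are those in $\mathbb C_g$. Standing assumptions: $\Sigma$ is right invertible (that matrix pencil has full row rank for all but finitely many $\lambda$), stabilizable, with no invariant zero at $0$ (continuous) or $1$ (discrete); algebraic and geometric multiplicities of each minimum-phase invariant zero coincide; no Jordan chains are allowed in the closed loop ($A+BF$ diagonalizable); in this part all closed-loop eigenvalues considered and all minimum-phase invariant zeros are real. Control: $u=Fx+Gr$, $F$ real with $\sigma(A+BF)\subset\mathbb C_g$, $G$ a right inverse of the closed-loop static gain. For constant $r$, $\epsilon=y-r$ satisfies $\mathcal D\xi=(A+BF)\xi$, $\epsilon=(C+DF)\xi$. State-to-output decoupling (with $\nu_i$ modes in output $i$):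 for any initial condition, $\epsilon_i(t)=\sum_{j=1}^{\nu_i}\beta_{i,j}e^{\lambda_{i,j}t}$ (resp. $\sum_j\beta_{i,j}\lambda_{i,j}^t$), $i=1,\ldots,p$, where the $\lambda_{i,j}$ are the observable closed-loop eigenvalues and the coefficients $\beta_{i,j}$ can be made arbitrary by choice of $\xi(0)$. That is, $A+BF$ has a basis of eigenvectors $v_{0,1},\ldots,v_{0,\nu_0},v_{1,1},\ldots,v_{p,\nu_p}$ with eigenvalues $\lambda_{i,j}$ such that $(C+DF)v_{0,j}=0$ and $(C+DF)v_{i,j}$ is a nonzero multiple of the $i$-th canonical vector $e_i\in\mathbb R^p$ for $i\ge1$; the $\lambda_{i,j}$ ($1\le j\le\nu_i$) are the eigenvalues observable from $\epsilon_i$ and the $\lambda_{0,j}$ the unobservable ones (all counted with multiplicity). Problem 3C: given nonnegative integers $\bar\nu_1,\ldots,\bar\nu_p$ with $\bar\nu_0=n-\sum_i\bar\nu_i\ge0$, find $F,G$ such that: (1) $y(t)\to\bar r$ for every constant reference $r(t)=\bar r$; (2) state-to-output decoupling is achieved; (3) from each $\epsilon_i$ at most $\bar\nu_i$ eigenvalues are observable ($\nu_i\le\bar\nu_i$; minimum-phase invariant zeros are allowed); neither the observable nor the unobservable eigenvalues are assigned a priori. Solvable means such $F,G$ exist. Subspaces: $\mathcal V^\star_g$ is the largest stabilizability output-nulling subspace of $\Sigma$: the largest subspace $\mathcal V\subseteq\mathbb R^n$ for which there is a real $F$ with $(A+BF)\mathcal V\subseteq\mathcal V\subseteq\ker(C+DF)$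 and $\sigma(A+BF|\mathcal V)\subset\mathbb C_g$. $\mathcal V^\star_{g,i}$ is the same subspace for the quadruple $(A,B,C_{(i)},D_{(i)})$, where $C_{(i)},D_{(i)}$ are $C,D$ with the $i$-th row removed. *)

theory Defs
  imports
    "HOL-Analysis.Analysis"
    "HOL-Library.Set_Algebras"
    "HOL-Computational_Algebra.Polynomial_Factorial"
    "HOL-Computational_Algebra.Field_as_Ring"
begin

datatype time_domain = Continuous | Discrete

text \<open>
  The dimensions n, m, p of state, input and output are the cardinalities of the index types
  \<open>'n\<close>, \<open>'m\<close>, \<open>'p\<close>. They are hence positive, and the set of output indices is \<open>UNIV :: 'p set\<close>.
\<close>

fun stab_region :: "time_domain \<Rightarrow> complex set" where
  "stab_region Continuous = {s. Re s < 0}"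
| "stab_region Discrete = {s. norm s < 1}"

text \<open>The point at which the transfer matrix has to be evaluated in order to get the static gain.\<close>

fun dc_point :: "time_domain \<Rightarrow> 'a :: {zero, one}" where
  "dc_point Continuous = 0"
| "dc_point Discrete = 1"


subsection \<open>Spectra\<close>

definition complex_mat :: "real ^ 'n ^ 'm \<Rightarrow> complex ^ 'n ^ 'm" where
  "complex_mat M = (\<chi> i j. complex_of_real (M $ i $ j))"

text \<open>
  Complex eigenvalues of the restriction of a real matrix to a real invariant subspace \<open>V\<close>:
  the eigenvectors range over the complexification of \<open>V\<close>.
\<close>

definition spectrum_on :: "real ^ 'n ^ 'n \<Rightarrow> (real ^ 'n) set \<Rightarrow> complex set" where
  "spectrum_on M V = {s. \<exists>v. v \<noteq> 0 \<and> (\<chi> i. Re (v $ i)) \<in> V \<and> (\<chi> i. Im (v $ i)) \<in> V \<and>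
                             complex_mat M *v v = s *s v}"

abbreviation spectrum :: "real ^ 'n ^ 'n \<Rightarrow> complex set" where
  "spectrum M \<equiv> spectrum_on M UNIV"


subsection \<open>System pencil and invariant zeros\<close>

text \<open>
  The pencil with entries in a ring containing the reals via the embedding \<open>h\<close>, at the ring
  element \<open>s\<close>. It is used with complex entries and with polynomial entries.
\<close>

definition pencil_over ::
  "(real \<Rightarrow> 'a::comm_ring_1) \<Rightarrow> real ^ 'n ^ 'n \<Rightarrow> real ^ 'm ^ 'n \<Rightarrow> real ^ 'n ^ 'p \<Rightarrow> real ^ 'm ^ 'p
    \<Rightarrow> 'a \<Rightarrow> 'a ^ ('n + 'm) ^ ('n + 'p)" where
  "pencil_over h A B C D s = (\<chi> i j.
     case (i, j) of
       (Inl a, Inl b) \<Rightarrow> h (A $ a $ b) - (if a = b then s else 0)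
     | (Inl a, Inr b) \<Rightarrow> h (B $ a $ b)
     | (Inr a, Inl b) \<Rightarrow> h (C $ a $ b)
     | (Inr a, Inr b) \<Rightarrow> h (D $ a $ b))"

definition pencil ::
  "real ^ 'n ^ 'n \<Rightarrow> real ^ 'm ^ 'n \<Rightarrow> real ^ 'n ^ 'p \<Rightarrow> real ^ 'm ^ 'p
    \<Rightarrow> complex \<Rightarrow> complex ^ ('n + 'm) ^ ('n + 'p)" where
  "pencil A B C D s = pencil_over complex_of_real A B C D s"

definition poly_pencil ::
  "real ^ 'n ^ 'n \<Rightarrow> real ^ 'm ^ 'n \<Rightarrow> real ^ 'n ^ 'p \<Rightarrow> real ^ 'm ^ 'p
    \<Rightarrow> complex poly ^ ('n + 'm) ^ ('n + 'p)" where
  "poly_pencil A B C D = pencil_over (\<lambda>x. [:complex_of_real x:]) A B C D [:0, 1:]"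

definition normal_rank ::
  "real ^ 'n ^ 'n \<Rightarrow> real ^ 'm ^ 'n \<Rightarrow> real ^ 'n ^ 'p \<Rightarrow> real ^ 'm ^ 'p \<Rightarrow> nat" where
  "normal_rank A B C D = Max (range (\<lambda>s. rank (pencil A B C D s)))"

definition invariant_zeros ::
  "real ^ 'n ^ 'n \<Rightarrow> real ^ 'm ^ 'n \<Rightarrow> real ^ 'n ^ 'p \<Rightarrow> real ^ 'm ^ 'p \<Rightarrow> complex set" where
  "invariant_zeros A B C D = {s. rank (pencil A B C D s) < normal_rank A B C D}"

definition min_phase_zeros ::
  "time_domain \<Rightarrow> real ^ 'n ^ 'n \<Rightarrow> real ^ 'm ^ 'n \<Rightarrow> real ^ 'n ^ 'p \<Rightarrow> real ^ 'm ^ 'p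
    \<Rightarrow> complex set" where
  "min_phase_zeros td A B C D = invariant_zeros A B C D \<inter> stab_region td"

definition right_invertible ::
  "real ^ 'n ^ 'n \<Rightarrow> real ^ 'm ^ 'n \<Rightarrow> real ^ 'n ^ 'p \<Rightarrow> real ^ 'm ^ 'p \<Rightarrow> bool" where
  "right_invertible A B C D \<longleftrightarrow>
     finite {s. rank (pencil A B C D s) \<noteq> CARD('n) + CARD('p)}"

definition zero_geom_mult ::
  "real ^ 'n ^ 'n \<Rightarrow> real ^ 'm ^ 'n \<Rightarrow> real ^ 'n ^ 'p \<Rightarrow> real ^ 'm ^ 'p \<Rightarrow> complex \<Rightarrow> nat" where
  "zero_geom_mult A B C D z = normal_rank A B C D - rank (pencil A B C D z)"

text \<open>
  The zero polynomial is the product of the invariant polynomials (equivalently, of all elementary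
  divisors) of the pencil, that is, the greatest common divisor of its minors of order normal rank.
  The definition below is meant for right invertible systems: the normal rank is then the number
  of rows, so these minors keep all rows and are given by a choice \<open>f\<close> of columns (a
  non-injective \<open>f\<close> only contributes a zero minor, irrelevant for the gcd).
\<close>

definition zero_poly ::
  "real ^ 'n ^ 'n \<Rightarrow> real ^ 'm ^ 'n \<Rightarrow> real ^ 'n ^ 'p \<Rightarrow> real ^ 'm ^ 'p \<Rightarrow> complex poly" where
  "zero_poly A B C D =
     Gcd (range (\<lambda>f :: 'n + 'p \<Rightarrow> 'n + 'm. det (\<chi> i j. poly_pencil A B C D $ i $ f j)))"

definition zero_alg_mult ::
  "real ^ 'n ^ 'n \<Rightarrow> real ^ 'm ^ 'n \<Rightarrow> real ^ 'n ^ 'p \<Rightarrow> real ^ 'm ^ 'p \<Rightarrow> complex \<Rightarrow> nat" where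
  "zero_alg_mult A B C D z = order z (zero_poly A B C D)"

definition stabilizable :: "time_domain \<Rightarrow> real ^ 'n ^ 'n \<Rightarrow> real ^ 'm ^ 'n \<Rightarrow> bool" where
  "stabilizable td A B \<longleftrightarrow> (\<exists>F :: real ^ 'n ^ 'm. spectrum (A + B ** F) \<subseteq> stab_region td)"


subsection \<open>Stabilizability output-nulling subspaces\<close>

text \<open>
  \<open>K\<close> is the set of output rows which are kept. Deleting rows in this way, rather than by changing
  the output type, also covers the deletion of the only row of a single-output system.
\<close>

definition stab_output_nulling ::
  "time_domain \<Rightarrow> real ^ 'n ^ 'n \<Rightarrow> real ^ 'm ^ 'n \<Rightarrow> real ^ 'n ^ 'p \<Rightarrow> real ^ 'm ^ 'p
    \<Rightarrow> 'p set \<Rightarrow> (real ^ 'n) set \<Rightarrow> bool" where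
  "stab_output_nulling td A B C D K V \<longleftrightarrow> subspace V \<and>
     (\<exists>F :: real ^ 'n ^ 'm.
        (\<lambda>x. (A + B ** F) *v x) ` V \<subseteq> V \<and>
        V \<subseteq> {x. \<forall>k\<in>K. ((C + D ** F) *v x) $ k = 0} \<and>
        spectrum_on (A + B ** F) V \<subseteq> stab_region td)"

definition largest_stab_output_nulling ::
  "time_domain \<Rightarrow> real ^ 'n ^ 'n \<Rightarrow> real ^ 'm ^ 'n \<Rightarrow> real ^ 'n ^ 'p \<Rightarrow> real ^ 'm ^ 'p
    \<Rightarrow> 'p set \<Rightarrow> (real ^ 'n) set" where
  "largest_stab_output_nulling td A B C D K = (GREATEST V. stab_output_nulling td A B C D K V)"

definition Vg ::
  "time_domain \<Rightarrow> real ^ 'n ^ 'n \<Rightarrow> real ^ 'm ^ 'n \<Rightarrow> real ^ 'n ^ 'p \<Rightarrow> real ^ 'm ^ 'p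
    \<Rightarrow> (real ^ 'n) set" where
  "Vg td A B C D = largest_stab_output_nulling td A B C D UNIV"

definition Vg_without ::
  "time_domain \<Rightarrow> real ^ 'n ^ 'n \<Rightarrow> real ^ 'm ^ 'n \<Rightarrow> real ^ 'n ^ 'p \<Rightarrow> real ^ 'm ^ 'p
    \<Rightarrow> 'p \<Rightarrow> (real ^ 'n) set" where
  "Vg_without td A B C D i = largest_stab_output_nulling td A B C D (UNIV - {i})"


subsection \<open>The tracking problem\<close>

definition static_gain ::
  "time_domain \<Rightarrow> real ^ 'n ^ 'n \<Rightarrow> real ^ 'm ^ 'n \<Rightarrow> real ^ 'n ^ 'p \<Rightarrow> real ^ 'm ^ 'p
    \<Rightarrow> real ^ 'n ^ 'm \<Rightarrow> real ^ 'm ^ 'p" where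
  "static_gain td A B C D F =
     (C + D ** F) ** matrix_inv (mat (dc_point td) - (A + B ** F)) ** B + D"

text \<open>Convergence of the output to any constant reference, from any initial state.\<close>

fun tracks_constants ::
  "time_domain \<Rightarrow> real ^ 'n ^ 'n \<Rightarrow> real ^ 'm ^ 'n \<Rightarrow> real ^ 'n ^ 'p \<Rightarrow> real ^ 'm ^ 'p
    \<Rightarrow> real ^ 'n ^ 'm \<Rightarrow> real ^ 'p ^ 'm \<Rightarrow> bool" where
  "tracks_constants Continuous A B C D F G \<longleftrightarrow>
     (\<forall>(r :: real ^ 'p) (x :: real \<Rightarrow> real ^ 'n) (u :: real \<Rightarrow> real ^ 'm).
        (\<forall>t\<ge>0. u t = F *v x t + G *v r) \<and>
        (\<forall>t\<ge>0. (x has_vector_derivative (A *v x t + B *v u t)) (at t within {0..})) \<longrightarrow>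
        ((\<lambda>t. C *v x t + D *v u t) \<longlongrightarrow> r) at_top)"
| "tracks_constants Discrete A B C D F G \<longleftrightarrow>
     (\<forall>(r :: real ^ 'p) (x :: nat \<Rightarrow> real ^ 'n) (u :: nat \<Rightarrow> real ^ 'm).
        (\<forall>t. u t = F *v x t + G *v r) \<and>
        (\<forall>t. x (Suc t) = A *v x t + B *v u t) \<longrightarrow>
        (\<lambda>t. C *v x t + D *v u t) \<longlonglongrightarrow> r)"

text \<open>
  State-to-output decoupling with \<open>\<nu> (Some i)\<close> modes in output \<open>i\<close>; the index \<open>None\<close> stands for
  the index 0 of the unobservable modes. The vectors \<open>v i j\<close>, \<open>j < \<nu> i\<close>, are the members of a
  basis of the real state space consisting of eigenvectors for the real eigenvalues \<open>\<mu> i j\<close>.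
\<close>

definition mode_vectors ::
  "('p option \<Rightarrow> nat) \<Rightarrow> ('p option \<Rightarrow> nat \<Rightarrow> real ^ 'n) \<Rightarrow> (real ^ 'n) set" where
  "mode_vectors \<nu> v = (\<lambda>(i, j). v i j) ` (SIGMA i:UNIV. {..<\<nu> i})"

definition decoupled_modes ::
  "real ^ 'n ^ 'n \<Rightarrow> real ^ 'm ^ 'n \<Rightarrow> real ^ 'n ^ 'p \<Rightarrow> real ^ 'm ^ 'p \<Rightarrow> real ^ 'n ^ 'm
    \<Rightarrow> ('p option \<Rightarrow> nat) \<Rightarrow> ('p option \<Rightarrow> nat \<Rightarrow> real ^ 'n) \<Rightarrow> ('p option \<Rightarrow> nat \<Rightarrow> real) \<Rightarrow> bool"
  where
  "decoupled_modes A B C D F \<nu> v \<mu> \<longleftrightarrow>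
     inj_on (\<lambda>(i, j). v i j) (SIGMA i:UNIV. {..<\<nu> i}) \<and>
     independent (mode_vectors \<nu> v) \<and> span (mode_vectors \<nu> v) = UNIV \<and>
     (\<forall>i. \<forall>j<\<nu> i. (A + B ** F) *v v i j = \<mu> i j *s v i j) \<and>
     (\<forall>j<\<nu> None. (C + D ** F) *v v None j = 0) \<and>
     (\<forall>i. \<forall>j<\<nu> (Some i). \<exists>c. c \<noteq> 0 \<and> (C + D ** F) *v v (Some i) j = c *s axis i 1)"

definition solves_problem_3C ::
  "time_domain \<Rightarrow> real ^ 'n ^ 'n \<Rightarrow> real ^ 'm ^ 'n \<Rightarrow> real ^ 'n ^ 'p \<Rightarrow> real ^ 'm ^ 'p
    \<Rightarrow> ('p \<Rightarrow> nat) \<Rightarrow> real ^ 'n ^ 'm \<Rightarrow> real ^ 'p ^ 'm \<Rightarrow> bool" where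
  "solves_problem_3C td A B C D nubar F G \<longleftrightarrow>
     spectrum (A + B ** F) \<subseteq> stab_region td \<and>
     static_gain td A B C D F ** G = mat 1 \<and>
     tracks_constants td A B C D F G \<and>
     (\<exists>\<nu> v \<mu>. decoupled_modes A B C D F \<nu> v \<mu> \<and> (\<forall>i. \<nu> (Some i) \<le> nubar i))"

definition problem_3C_solvable ::
  "time_domain \<Rightarrow> real ^ 'n ^ 'n \<Rightarrow> real ^ 'm ^ 'n \<Rightarrow> real ^ 'n ^ 'p \<Rightarrow> real ^ 'm ^ 'p
    \<Rightarrow> ('p \<Rightarrow> nat) \<Rightarrow> bool" where
  "problem_3C_solvable td A B C D nubar \<longleftrightarrow> (\<exists>F G. solves_problem_3C td A B C D nubar F G)"

end

theory Submission
  imports Defs "HOL-Computational_Algebra.Fundamental_Theorem_Algebra"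
begin

text \<open>
  Let \<open>E K\<close> be the set of states \<open>x\<close> for which some \<open>u\<close> and some real stable \<open>lam\<close> satisfy
  \<open>A x + B u = lam x\<close> and \<open>(C x + D u)\<^sub>k = 0\<close> for \<open>k \<in> K\<close>. Closed-loop eigenvectors with no output in
  the rows \<open>K\<close> belong to \<open>E K\<close>, and conversely pairs \<open>(x, u)\<close> of this kind whose states form a
  basis are realised by one feedback. Hence Problem 3C asks for a linearly independent
  transversal of copies of the sets \<open>E UNIV\<close> and \<open>E (UNIV - {i})\<close>, and Rado's theorem turns this into
  the dimension inequalities, once the largest stabilizability output-nulling subspace is
  identified with \<open>span (E K)\<close>.

  For this identification let \<open>l\<close> annihilate \<open>E K\<close>. Then \<open>(l, 0)\<close> lies in the row space of the pencil
  at infinitely many points, so that \<open>q P = d (l, 0)\<close> for a polynomial row \<open>q\<close> and a nonzero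
  polynomial \<open>d\<close>. If \<open>d\<close> has minimal degree, it has no stable root, because stable zeros are real and
  semisimple. On a stabilizability output-nulling subspace \<open>V\<close> with closed-loop map \<open>M\<close> the relation
  becomes \<open>q (M - s) = d l\<close>; all \<open>M - z\<close> with \<open>z\<close> a root of \<open>d\<close> are invertible on \<open>V\<close>, so the roots
  of \<open>d\<close> can be cancelled one by one, and a comparison of degrees gives \<open>l = 0\<close> on \<open>V\<close>.
\<close>

subsection \<open>Rank over a field\<close>

lemma rank_le_card_row_generators:
  fixes P :: "'a::field ^ 'c ^ 'q"
  assumes "rows P \<subseteq> vec.span (g ` S)" "finite S"
  shows "rank P \<le> card S"
proof -
  have "vec.dim (rows P) \<le> card (g ` S)"
    using vec.dim_le_card[OF assms(1)] assms(2) by blast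
  also have "\<dots> \<le> card S" using card_image_le assms(2) by blast
  finally show ?thesis by (simp add: row_rank_def_gen)
qed

lemma rank_le_rows: "rank (P :: 'a::field ^ 'c ^ 'q) \<le> CARD('q)"
proof (rule rank_le_card_row_generators)
  show "rows P \<subseteq> vec.span (range (\<lambda>i. row i P))"
    by (auto simp: rows_def intro!: vec.span_base)
qed simp

text \<open>A nonzero coefficient in a vanishing combination of rows would make that row redundant,
  and the remaining \<open>CARD('q) - 1\<close> rows would bound the rank.\<close>

lemma full_rank_right_inverse:
  fixes P :: "'a::field ^ 'c ^ 'q"
  assumes "rank P = CARD('q)"
  shows "\<exists>R :: 'a ^ 'q ^ 'c. P ** R = mat 1"
  unfolding matrix_right_invertible_independent_rows
proof (intro allI impI)
  fix c :: "'q \<Rightarrow> 'a" and i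
  assume c: "(\<Sum>i\<in>UNIV. c i *s row i P) = 0"
  show "c i = 0"
  proof (rule ccontr)
    assume ci: "c i \<noteq> 0"
    let ?S = "vec.span ((\<lambda>k. row k P) ` (UNIV - {i}))"
    have "c i *s row i P + (\<Sum>k\<in>UNIV - {i}. c k *s row k P) = 0"
      using c by (subst (asm) sum.remove[of UNIV i]) auto
    then have eq: "c i *s row i P = - (\<Sum>k\<in>UNIV - {i}. c k *s row k P)"
      by (simp add: eq_neg_iff_add_eq_0)
    have "(\<Sum>k\<in>UNIV - {i}. c k *s row k P) \<in> ?S"
      by (intro vec.span_sum vec.span_scale vec.span_base) auto
    then have "c i *s row i P \<in> ?S" unfolding eq by (rule vec.span_neg)
    then have "(1 / c i) *s (c i *s row i P) \<in> ?S" by (rule vec.span_scale)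
    then have ri: "row i P \<in> ?S" using ci by (simp add: vec_eq_iff vector_smult_assoc)
    have "rows P \<subseteq> ?S"
    proof
      fix x assume "x \<in> rows P"
      then obtain k where "x = row k P" by (auto simp: rows_def)
      then show "x \<in> ?S" using ri by (cases "k = i") (auto intro: vec.span_base)
    qed
    from rank_le_card_row_generators[OF this] have "rank P \<le> CARD('q) - 1" by (simp add: card_Diff_singleton)
    then show False using assms zero_less_card_finite[where 'a='q] by linarith
  qed
qed

text \<open>A basis of the column space picked among the columns has \<open>CARD('q)\<close>
  members. The square matrix formed by them has a right inverse, hence a nonzero
  determinant.\<close>

lemma full_rank_column_selection:
  fixes P :: "'a::field ^ 'c ^ 'q"
  assumes "rank P = CARD('q)"
  shows "\<exists>f :: 'q \<Rightarrow> 'c. det (\<chi> i j. P $ i $ f j) \<noteq> 0"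
proof -
  have sp: "vec.span (columns P) = UNIV"
    using full_rank_right_inverse[OF assms] by (simp add: matrix_right_invertible_span_columns)
  obtain S where S: "S \<subseteq> columns P" "vec.independent S" "columns P \<subseteq> vec.span S"
    "card S = vec.dim (columns P)"
    using vec.basis_exists by blast
  have spS: "vec.span S = UNIV"
    using vec.span_minimal[OF S(3) vec.subspace_span] sp by blast
  have "vec.dim (columns P) = CARD('q)"
    using sp by (metis vec.dim_span vec_dim_card)
  then have "card S = CARD('q)" using S(4) by simp
  moreover have fS: "finite S" using S(2) vec.finiteI_independent by blast
  ultimately obtain h :: "'q \<Rightarrow> 'a ^ 'q" where h: "bij_betw h UNIV S"
    using finite_same_card_bij[of "UNIV :: 'q set" S] by auto
  have "\<forall>j. \<exists>k. h j = column k P"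
    using h S(1) by (fastforce simp: columns_def bij_betw_def)
  then obtain f where f: "\<And>j. h j = column (f j) P" by metis
  let ?Q = "\<chi> i j. P $ i $ f j"
  have "column j ?Q = h j" for j by (simp add: f column_def vec_eq_iff)
  then have "columns ?Q = S" using h by (auto simp: columns_def bij_betw_def)
  then have "\<exists>R. ?Q ** R = mat 1" using spS by (simp add: matrix_right_invertible_span_columns)
  then show ?thesis
    by (metis det_I det_mul mult_zero_left zero_neq_one)
qed

text \<open>Rank-nullity with the null vector \<open>p\<close> prescribed: a basis of the left
  kernel through \<open>p\<close> is extended to a basis of the whole space, whose members become
  the rows of \<open>U\<close>. \<open>S\<close> indexes the rows taken from the kernel.\<close>

lemma extend_left_null_vector:
  fixes P :: "'a::field ^ 'c ^ 'q"
  assumes "p v* P = 0" "p \<noteq> 0"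
  shows "\<exists>(U :: 'a ^ 'q ^ 'q) S i. invertible U \<and> i \<in> S \<and> U $ i = p \<and>
     (\<forall>k\<in>S. (U $ k) v* P = 0) \<and> CARD('q) - rank P \<le> card S"
proof -
  define N where "N = {x. x v* P = 0}"
  have lin: "Vector_Spaces.linear (*s) (*s) (\<lambda>x. x v* P)"
    unfolding transpose_matrix_vector[symmetric] by (rule matrix_vector_mul_linear_gen)
  interpret L: Vector_Spaces.linear "(*s)" "(*s)" "\<lambda>x. x v* P" by (rule lin)
  have subN: "vec.subspace N"
    unfolding N_def vec.subspace_def by (auto simp: L.add L.scale)
  have ind: "vec.independent {p}" using assms(2) by (simp add: vec.independent_insert)
  have pN: "{p} \<subseteq> N" using assms(1) by (auto simp: N_def)
  obtain BN where BN: "{p} \<subseteq> BN" "BN \<subseteq> N" "vec.independent BN" "N \<subseteq> vec.span BN"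
    by (rule vec.maximal_independent_subset_extend[OF pN ind])
  obtain BB where BB: "BN \<subseteq> BB" "vec.independent BB" "UNIV \<subseteq> vec.span BB"
    by (rule vec.maximal_independent_subset_extend[OF subset_UNIV BN(3)])
  have fin: "finite BB" using BB(2) vec.finiteI_independent by blast
  have cBB: "card BB = CARD('q)"
    using vec.basis_card_eq_dim[OF subset_UNIV BB(3,2)] by (simp add: card_cart_basis vec.dimension_def)
  then obtain h :: "'q \<Rightarrow> 'a ^ 'q" where h: "bij_betw h UNIV BB"
    using fin cBB finite_same_card_bij[of "UNIV :: 'q set" BB] by auto
  define U where "U = (\<chi> i. h i)"
  define S where "S = {k. h k \<in> BN}"
  obtain i where i: "h i = p" using h BN(1) BB(1) unfolding bij_betw_def by blast
  have rU: "row k U = h k" for k by (simp add: U_def row_def vec_eq_iff)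
  then have "rows U = BB" using h by (auto simp: rows_def bij_betw_def)
  then have "vec.span (rows U) = UNIV" using BB(3) by blast
  then have "invertible U"
    by (metis matrix_left_invertible_span_rows_gen invertible_left_inverse)
  moreover have "CARD('q) - rank P \<le> card S"
  proof -
    let ?f = "\<lambda>y. y v* P" and ?T = "BB - BN"
    have indT: "vec.independent ?T" using BB(2) vec.independent_mono by blast
    \<comment> \<open>Such an \<open>x\<close> lies in the spans of \<open>BB - BN\<close> and of
      \<open>BN\<close>. Its representation in the basis \<open>BB\<close> is supported on both of
      these disjoint sets, so it vanishes.\<close>
    have "x = 0" if x: "x \<in> vec.span ?T" "?f x = 0" for x
    proof -
      have xN: "x \<in> vec.span BN" using x(2) BN(4) by (auto simp: N_def)
      have "vec.representation ?T x = vec.representation BN x"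
        using vec.representation_extend[OF BB(2) x(1)] vec.representation_extend[OF BB(2) xN BB(1)]
        by auto
      then have "vec.representation ?T x b = 0" for b
        by (metis DiffD2 vec.representation_ne_zero)
      then show "x = 0"
        using vec.sum_nonzero_representation_eq[OF indT x(1)] by simp
    qed
    then have "inj_on ?f (vec.span ?T)"
      by (simp add: L.inj_on_iff_eq_0)
    then have "vec.dim (?f ` ?T) = vec.dim ?T"
      by (rule vec.dim_image_eq[OF lin])
    also have "vec.dim ?T = card ?T" using vec.dim_eq_card_independent[OF indT] .
    also have "card ?T = CARD('q) - card BN"
      using cBB BB(1) fin by (simp add: card_Diff_subset finite_subset)
    finally have "CARD('q) - card BN = vec.dim (?f ` ?T)" by simp
    also have "?f ` ?T \<subseteq> vec.span (rows P)"
    proof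
      fix y assume "y \<in> ?f ` ?T"
      then obtain x where y: "y = x v* P" by blast
      have "y = (\<Sum>k\<in>UNIV. x $ k *s row k P)"
        by (simp add: y vec_eq_iff vector_matrix_mult_def row_def mult.commute)
      moreover have "\<dots> \<in> vec.span (rows P)"
        by (intro vec.span_sum vec.span_scale vec.span_base) (auto simp: rows_def)
      ultimately show "y \<in> vec.span (rows P)" by simp
    qed
    then have "vec.dim (?f ` ?T) \<le> rank P"
      unfolding row_rank_def_gen by (rule vec.dim_mono)
    finally have "CARD('q) - card BN \<le> rank P" .
    moreover have "bij_betw h S BN"
      using h BB(1) unfolding S_def bij_betw_def by (auto simp: inj_on_def)
    then have "card S = card BN" by (rule bij_betw_same_card)
    ultimately show ?thesis by linarith
  qed
  moreover have "i \<in> S" using i BN(1) by (auto simp: S_def)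
  moreover have "U $ i = p" by (simp add: U_def i)
  moreover have "\<forall>k\<in>S. (U $ k) v* P = 0" using BN(2) by (auto simp: S_def U_def N_def)
  ultimately show ?thesis by blast
qed

lemma poly_det: "poly (det M) s = det (\<chi> i j. poly (M $ i $ j) s)"
  for M :: "'a::comm_ring_1 poly ^ 'q ^ 'q"
  by (simp add: det_def poly_sum poly_prod)

subsection \<open>Left null vectors of the pencil at a zero\<close>

lemma poly_poly_pencil: "poly (poly_pencil A B C D $ i $ j) s = pencil A B C D s $ i $ j"
  by (cases i; cases j) (simp_all add: poly_pencil_def pencil_def pencil_over_def)

lemma card_rows_pencil: "CARD('n::finite + 'p::finite) = CARD('n) + CARD('p)"
  by (simp flip: UNIV_Plus_UNIV add: card_Plus)

lemma right_invertible_full_rank_nonempty: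
  fixes A :: "real ^ 'n ^ 'n" and B :: "real ^ 'm ^ 'n"
    and C :: "real ^ 'n ^ 'p" and D :: "real ^ 'm ^ 'p"
  assumes "right_invertible A B C D"
  shows "\<exists>s. rank (pencil A B C D s) = CARD('n + 'p)"
proof -
  have "finite {s. rank (pencil A B C D s) \<noteq> CARD('n + 'p)}"
    using assms unfolding right_invertible_def card_rows_pencil .
  moreover have "infinite (UNIV :: complex set)" by (rule infinite_UNIV_char_0)
  ultimately have "{s. rank (pencil A B C D s) \<noteq> CARD('n + 'p)} \<noteq> UNIV" by metis
  then show ?thesis by blast
qed

lemma right_invertible_normal_rank:
  fixes A :: "real ^ 'n ^ 'n" and B :: "real ^ 'm ^ 'n"
    and C :: "real ^ 'n ^ 'p" and D :: "real ^ 'm ^ 'p"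
  assumes "right_invertible A B C D"
  shows "normal_rank A B C D = CARD('n + 'p)"
  unfolding normal_rank_def
proof (rule Max_eqI)
  show "finite (range (\<lambda>s. rank (pencil A B C D s)))"
    by (rule finite_subset[OF _ finite_atMost[of "CARD('n + 'p)"]])
      (metis atMost_iff image_subsetI rank_le_rows)
  show "CARD('n + 'p) \<in> range (\<lambda>s. rank (pencil A B C D s))"
    using right_invertible_full_rank_nonempty[OF assms] by (metis rangeI)
qed (metis imageE rank_le_rows)

text \<open>A minor that is nonzero at one point of full rank is a nonzero polynomial. It guarantees
  that \<open>zero_poly\<close> is nonzero and later serves as the common denominator in Cramer's
  rule.\<close>

lemma right_invertible_nonzero_minor:
  fixes A :: "real ^ 'n ^ 'n" and B :: "real ^ 'm ^ 'n"
    and C :: "real ^ 'n ^ 'p" and D :: "real ^ 'm ^ 'p"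
  assumes "right_invertible A B C D"
  shows "\<exists>f :: 'n + 'p \<Rightarrow> 'n + 'm. det (\<chi> i j. poly_pencil A B C D $ i $ f j) \<noteq> 0"
proof -
  obtain s where "rank (pencil A B C D s) = CARD('n + 'p)"
    using right_invertible_full_rank_nonempty[OF assms] by blast
  then obtain f :: "'n + 'p \<Rightarrow> 'n + 'm" where "det (\<chi> i j. pencil A B C D s $ i $ f j) \<noteq> 0"
    using full_rank_column_selection by blast
  then have "poly (det (\<chi> i j. poly_pencil A B C D $ i $ f j)) s \<noteq> 0"
    by (simp add: poly_det poly_poly_pencil)
  then show ?thesis by (metis poly_0)
qed

text \<open>The variable enters the pencil only through the identity block of the state rows, so the
  expansion about \<open>z\<close> stops exactly after the linear term.\<close>

lemma row_mult_pencil_shift: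
  fixes x :: "complex ^ ('n::finite + 'p::finite)"
  shows "x v* pencil A B C D s =
    x v* pencil A B C D z - (s - z) *s (\<chi> j. case j of Inl b \<Rightarrow> x $ Inl b | Inr _ \<Rightarrow> 0)"
proof -
  have "pencil A B C D s $ i $ j = pencil A B C D z $ i $ j
      - (s - z) * (case j of Inl b \<Rightarrow> (if i = Inl b then 1 else 0) | Inr _ \<Rightarrow> 0)" for i j
    by (cases i; cases j) (auto simp: pencil_def pencil_over_def)
  then have "(x v* pencil A B C D s) $ j = (x v* pencil A B C D z) $ j
      - (s - z) * (\<Sum>i\<in>UNIV. x $ i *
          (case j of Inl b \<Rightarrow> (if i = Inl b then 1 else 0) | Inr _ \<Rightarrow> 0))" for j
    by (simp add: vector_matrix_mult_def left_diff_distrib right_diff_distrib sum_subtractf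
        sum_distrib_left mult_ac)
  then show ?thesis
    by (simp add: vec_eq_iff mult_delta_right left_diff_distrib split: sum.split)
qed

text \<open>
  Otherwise complete \<open>p\<close> by further left null vectors at \<open>z\<close> to an invertible matrix and replace the
  row \<open>p\<close> by \<open>p + (X - z) e\<close>. Multiplying the pencil by this matrix from the left shows that all
  maximal minors are divisible by \<open>(X - z)\<close> to the power geometric multiplicity plus one.
\<close>

lemma semisimple_zero_no_left_chain:
  fixes A :: "real ^ 'n ^ 'n" and B :: "real ^ 'm ^ 'n"
    and C :: "real ^ 'n ^ 'p" and D :: "real ^ 'm ^ 'p" and p e :: "complex ^ ('n + 'p)"
  assumes ri: "right_invertible A B C D"
    and mult: "zero_alg_mult A B C D z = zero_geom_mult A B C D z"
    and p: "p v* pencil A B C D z = 0"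
    and e: "e v* pencil A B C D z = (\<chi> j. case j of Inl b \<Rightarrow> p $ Inl b | Inr _ \<Rightarrow> 0)"
  shows "p = 0"
proof (rule ccontr)
  let ?P = "pencil A B C D"
  assume "p \<noteq> 0"
  with p obtain U :: "complex ^ ('n + 'p) ^ ('n + 'p)" and S i
    where U: "invertible U" "i \<in> S" "U $ i = p" "\<And>k. k \<in> S \<Longrightarrow> (U $ k) v* ?P z = 0"
      "CARD('n + 'p) - rank (?P z) \<le> card S"
    using extend_left_null_vector by metis
  define Up where "Up = (\<chi> k j. if k = i then [:p $ j - z * e $ j, e $ j:] else [:U $ k $ j:])"
  \<comment> \<open>The power of \<open>X - z\<close> that will divide row \<open>k\<close> of the
    product: two for the modified row, one for every other null row.\<close>
  define m where "m = (\<lambda>k. if k = i then 2 else if k \<in> S then 1 else 0 :: nat)"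
  have sum_m: "sum m UNIV = card S + 1"
  proof -
    have "m = (\<lambda>k. (if k \<in> S then 1 else 0) + (if k = i then 1 else 0))"
      using U(2) by (auto simp: m_def)
    then show ?thesis by (simp add: sum.distrib sum.If_cases)
  qed
  have Up_i: "(\<chi> j. poly (Up $ i $ j) s) = p + (s - z) *s e" for s
    by (simp add: Up_def vec_eq_iff algebra_simps)
  have dvd_minor: "[:- z, 1:] ^ (card S + 1) dvd det (\<chi> i j. poly_pencil A B C D $ i $ f j)"
    for f :: "'n + 'p \<Rightarrow> 'n + 'm"
  proof -
    define Pf where "Pf = (\<chi> i j. poly_pencil A B C D $ i $ f j)"
    have entry: "poly ((Up ** Pf) $ k $ j) s = ((\<chi> j. poly (Up $ k $ j) s) v* ?P s) $ f j" for k j s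
      by (simp add: matrix_matrix_mult_def Pf_def poly_sum poly_poly_pencil vector_matrix_mult_def
          mult.commute)
    have "[:- z, 1:] ^ m k dvd (Up ** Pf) $ k $ j" for k j
    proof (cases "k = i")
      case True
      \<comment> \<open>The chain relation for \<open>e\<close> cancels the first-order terms in
        \<open>s - z\<close> of the expansion about \<open>z\<close>, so a double factor
        remains.\<close>
      have "poly ((Up ** Pf) $ i $ j) s = poly ([:- z, 1:] ^ 2 *
              [:- (case f j of Inl b \<Rightarrow> e $ Inl b | Inr _ \<Rightarrow> 0):]) s" for s
      proof -
        define tr :: "complex ^ ('n + 'p) \<Rightarrow> 'n + 'm \<Rightarrow> complex"
          where "tr x k = (case k of Inl b \<Rightarrow> x $ Inl b | Inr _ \<Rightarrow> 0)" for x k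
        have a: "((p + (s - z) *s e) v* ?P s) $ k = (p v* ?P s) $ k + (s - z) * (e v* ?P s) $ k" for k
          by (simp add: vector_matrix_mult_def ring_distribs sum.distrib sum_distrib_left
              sum_subtractf mult_ac)
        have b: "(p v* ?P s) $ k = - (s - z) * tr p k"
          and c: "(e v* ?P s) $ k = tr p k - (s - z) * tr e k" for k
          by (simp_all add: row_mult_pencil_shift[of _ A B C D s z] p e tr_def left_diff_distrib)
        show ?thesis
          unfolding entry Up_i a b c tr_def[symmetric] by (simp add: algebra_simps power2_eq_square)
      qed
      then have "(Up ** Pf) $ i $ j = [:- z, 1:] ^ 2 *
              [:- (case f j of Inl b \<Rightarrow> e $ Inl b | Inr _ \<Rightarrow> 0):]"
        by (intro poly_eq_poly_eq_iff[THEN iffD1] ext)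
      then show ?thesis using True by (simp only: m_def simp_thms if_True dvd_triv_left)
    next
      case False
      have "poly ((Up ** Pf) $ k $ j) z = 0" if "k \<in> S"
        unfolding entry using False U(4)[OF that] by (simp add: Up_def vec_lambda_eta)
      then show ?thesis using False by (auto simp: m_def poly_eq_0_iff_dvd)
    qed
    then obtain Q where Q: "\<And>k j. (Up ** Pf) $ k $ j = [:- z, 1:] ^ m k * Q k j"
      unfolding dvd_def by metis
    have eq: "Up ** Pf = (\<chi> k. [:- z, 1:] ^ m k *s (\<chi> j. Q k j))"
      by (simp add: vec_eq_iff Q)
    have "det Up * det Pf = det (Up ** Pf)"
      by (rule det_mul[symmetric])
    also have "\<dots> = (\<Prod>k\<in>UNIV. [:- z, 1:] ^ m k) * det (\<chi> k. \<chi> j. Q k j)"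
      unfolding eq by (rule det_rows_mul)
    also have "(\<Prod>k\<in>UNIV. [:- z, 1:] ^ m k) = [:- z, 1:] ^ (card S + 1)"
      by (simp only: power_sum[symmetric] sum_m)
    finally have dvd: "[:- z, 1:] ^ (card S + 1) dvd det Up * det Pf" by (metis dvd_triv_left)
    \<comment> \<open>At \<open>z\<close> the modified row returns to \<open>p\<close>. Thus
      \<open>det Up\<close> does not vanish at \<open>z\<close>, and the whole power of
      \<open>X - z\<close> must divide the minor \<open>det Pf\<close>.\<close>
    have "(\<chi> k j. poly (Up $ k $ j) z) = U"
      using U(3) by (auto simp: vec_eq_iff Up_def)
    then have "poly (det Up) z \<noteq> 0"
      using U(1) by (simp add: poly_det invertible_det_nz)
    then have "det Up \<noteq> 0" "order z (det Up) = 0" by (auto intro: order_0I)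
    then have "det Pf = 0 \<or> order z (det Up * det Pf) = order z (det Pf)"
      using order_mult[of "det Up" "det Pf" z] by auto
    then have "[:- z, 1:] ^ (card S + 1) dvd det Pf"
      using dvd \<open>det Up \<noteq> 0\<close> unfolding order_divides by auto
    then show ?thesis by (simp only: Pf_def)
  qed
  have "[:- z, 1:] ^ (card S + 1) dvd zero_poly A B C D"
    unfolding zero_poly_def by (rule Gcd_greatest) (use dvd_minor in blast)
  moreover have "zero_poly A B C D \<noteq> 0"
    using right_invertible_nonzero_minor[OF ri] unfolding zero_poly_def Gcd_0_iff by blast
  ultimately have "card S + 1 \<le> zero_alg_mult A B C D z"
    unfolding zero_alg_mult_def order_divides by blast
  then show False
    using U(5) by (simp add: mult zero_geom_mult_def right_invertible_normal_rank[OF ri])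
qed

subsection \<open>Polynomial relations from annihilators\<close>

text \<open>This is the set \<open>E K\<close> of the introduction. It is a union of subspaces, one
  for each \<open>lam\<close>, and need not be a subspace itself; hence the spans taken of it
  later.\<close>

definition mode_set ::
  "time_domain \<Rightarrow> real ^ 'n ^ 'n \<Rightarrow> real ^ 'm ^ 'n \<Rightarrow> real ^ 'n ^ 'p \<Rightarrow> real ^ 'm ^ 'p
    \<Rightarrow> 'p set \<Rightarrow> (real ^ 'n) set" where
  "mode_set td A B C D K = {x. \<exists>lam u. complex_of_real lam \<in> stab_region td \<and>
     A *v x + B *v u = lam *s x \<and> (\<forall>k\<in>K. (C *v x + D *v u) $ k = 0)}"

definition state_row :: "real ^ 'n \<Rightarrow> complex ^ ('n::finite + 'm::finite)" where
  "state_row l = (\<chi> j. case j of Inl b \<Rightarrow> complex_of_real (l $ b) | Inr _ \<Rightarrow> 0)"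

text \<open>The relation \<open>q P = d (l, 0)\<close> for the polynomial pencil \<open>P\<close>.
  Output rows outside \<open>K\<close> get coefficient zero, which amounts to deleting them from the
  system.\<close>

definition row_relation ::
  "real ^ 'n ^ 'n \<Rightarrow> real ^ 'm ^ 'n \<Rightarrow> real ^ 'n ^ 'p \<Rightarrow> real ^ 'm ^ 'p \<Rightarrow> 'p set \<Rightarrow> real ^ 'n
    \<Rightarrow> ('n + 'p \<Rightarrow> complex poly) \<Rightarrow> complex poly \<Rightarrow> bool" where
  "row_relation A B C D K l q d \<longleftrightarrow> d \<noteq> 0 \<and> (\<forall>k. k \<notin> K \<longrightarrow> q (Inr k) = 0) \<and>
     (\<forall>j. (\<Sum>i\<in>UNIV. q i * poly_pencil A B C D $ i $ j) = d * [:state_row l $ j:])"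

text \<open>Provides enough points to prove polynomial identities that are checked only at real
  stable points. The interval from -1 to 0 lies in both stability regions.\<close>

lemma infinite_stable_reals: "infinite {s \<in> stab_region td. s \<in> \<real>}"
proof -
  have "infinite (complex_of_real ` {-1<..<0})"
    by (simp add: finite_image_iff inj_on_def)
  moreover have "complex_of_real ` {-1<..<0} \<subseteq> {s \<in> stab_region td. s \<in> \<real>}"
    by (cases td) auto
  ultimately show ?thesis using infinite_super by blast
qed

lemma sum_UNIV_Plus: "(\<Sum>i\<in>UNIV. g i) = (\<Sum>a\<in>UNIV. g (Inl a)) + (\<Sum>b\<in>UNIV. g (Inr b))"
  for g :: "'a::finite + 'b::finite \<Rightarrow> 'c::comm_monoid_add"
  by (simp flip: UNIV_Plus_UNIV add: sum.Plus)

text \<open>Fredholm alternative at a real stable point: the component \<open>z\<close> of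
  \<open>(l, 0)\<close> orthogonal to the row space lies in the kernel of the pencil, so its state
  part is a mode. As \<open>l\<close> annihilates modes, \<open>z\<close> is orthogonal to
  \<open>(l, 0)\<close> and hence to itself.\<close>

lemma annihilator_in_row_space:
  fixes A :: "real ^ 'n ^ 'n" and B :: "real ^ 'm ^ 'n"
    and C :: "real ^ 'n ^ 'p" and D :: "real ^ 'm ^ 'p"
  assumes l: "\<And>x. x \<in> mode_set td A B C D K \<Longrightarrow> l \<bullet> x = 0"
    and s: "s \<in> stab_region td" "s \<in> \<real>"
  shows "\<exists>c. (\<forall>k. k \<notin> K \<longrightarrow> c $ Inr k = 0) \<and> c v* pencil A B C D s = state_row l"
proof -
  obtain lam where lam: "s = complex_of_real lam" using s(2) by (auto elim: Reals_cases)
  \<comment> \<open>Deleted outputs become zero rows, so that the row index type stays the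
    same.\<close>
  define Q where "Q = (\<chi> i j. case i of
      Inl _ \<Rightarrow> pencil_over id A B C D lam $ i $ j
    | Inr k \<Rightarrow> if k \<in> K then pencil_over id A B C D lam $ i $ j else 0)"
  define r :: "real ^ ('n + 'm)" where "r = (\<chi> j. case j of Inl b \<Rightarrow> l $ b | Inr _ \<Rightarrow> 0)"
  have sub: "subspace (range (\<lambda>\<eta>. \<eta> v* Q))"
    using linear_subspace_image[OF matrix_vector_mul_linear[of "transpose Q"] subspace_UNIV] by simp
  obtain y z where yz: "y \<in> span (range (\<lambda>\<eta>. \<eta> v* Q))"
      "\<And>w. w \<in> span (range (\<lambda>\<eta>. \<eta> v* Q)) \<Longrightarrow> orthogonal z w" "r = y + z"
    using orthogonal_subspace_decomp_exists by blast
  have "\<eta> \<bullet> (Q *v z) = 0" for \<eta>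
    using yz(2)[of "\<eta> v* Q"] by (simp add: span_base orthogonal_def inner_commute flip: dot_lmul_matrix)
  then have Qz: "Q *v z = 0" by (metis inner_eq_zero_iff)
  define x u where "x = (\<chi> b. z $ Inl b)" and "u = (\<chi> c. z $ Inr c)"
  have "(A *v x + B *v u) $ a = lam * x $ a" for a
  proof -
    have "(Q *v z) $ Inl a = (A *v x + B *v u) $ a - lam * x $ a"
      by (simp add: Q_def matrix_vector_mult_def sum_UNIV_Plus pencil_over_def x_def u_def
          left_diff_distrib sum_subtractf mult_delta_left)
    then show ?thesis using Qz by simp
  qed
  moreover have "(C *v x + D *v u) $ k = 0" if "k \<in> K" for k
  proof -
    have "(Q *v z) $ Inr k = (C *v x + D *v u) $ k"
      using that by (simp add: Q_def matrix_vector_mult_def sum_UNIV_Plus pencil_over_def x_def u_def)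
    then show ?thesis using Qz by simp
  qed
  ultimately have "x \<in> mode_set td A B C D K"
    unfolding mode_set_def using s(1) lam by (auto simp: vec_eq_iff)
  then have "r \<bullet> z = 0"
    using l[of x] by (simp add: r_def inner_vec_def sum_UNIV_Plus x_def)
  moreover have "y \<bullet> z = 0" using yz(1,2) by (simp add: orthogonal_def inner_commute)
  ultimately have "z = 0" using yz(3) by (simp add: inner_add_left)
  then have "r \<in> range (\<lambda>\<eta>. \<eta> v* Q)"
    using yz(1,3) sub by (metis add.right_neutral span_eq_iff)
  then obtain \<eta> where \<eta>: "r = \<eta> v* Q" by blast
  \<comment> \<open>Coefficients at deleted outputs multiply zero rows of \<open>Q\<close> and may
    be reset to zero.\<close>
  define c where "c = (\<chi> i. case i of
      Inl a \<Rightarrow> complex_of_real (\<eta> $ i)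
    | Inr k \<Rightarrow> if k \<in> K then complex_of_real (\<eta> $ i) else 0)"
  have "(c v* pencil A B C D s) $ j = state_row l $ j" for j
  proof -
    have "(c v* pencil A B C D s) $ j = complex_of_real ((\<eta> v* Q) $ j)"
      unfolding vector_matrix_mult_def vec_lambda_beta of_real_sum
      by (rule sum.cong)
        (auto simp: c_def Q_def pencil_def pencil_over_def lam split: sum.split)
    also have "\<dots> = state_row l $ j"
      by (simp add: \<eta>[symmetric] r_def state_row_def split: sum.split)
    finally show ?thesis .
  qed
  then show ?thesis by (intro exI[of _ c]) (auto simp: vec_eq_iff c_def)
qed

text \<open>Cramer's rule with a nonzero maximal minor \<open>d\<close> as common denominator. The
  equations hold at infinitely many real stable points, hence as polynomial identities.\<close>

lemma row_relation_exists:
  fixes A :: "real ^ 'n ^ 'n" and B :: "real ^ 'm ^ 'n"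
    and C :: "real ^ 'n ^ 'p" and D :: "real ^ 'm ^ 'p"
  assumes ri: "right_invertible A B C D"
    and l: "\<And>x. x \<in> mode_set td A B C D K \<Longrightarrow> l \<bullet> x = 0"
  shows "\<exists>q d. row_relation A B C D K l q d"
proof -
  let ?PP = "poly_pencil A B C D"
  let ?S = "{s \<in> stab_region td. s \<in> \<real>}"
  obtain f :: "'n + 'p \<Rightarrow> 'n + 'm" where f: "det (\<chi> i j. ?PP $ i $ f j) \<noteq> 0"
    using right_invertible_nonzero_minor[OF ri] by blast
  define d where "d = det (\<chi> i j. ?PP $ i $ f j)"
  define q where "q = (\<lambda>k. det (\<chi> i j. if i = k then [:state_row l $ f j:] else ?PP $ i $ f j))"
  \<comment> \<open>The coefficients \<open>c\<close> depend on \<open>s\<close> in an uncontrolled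
    way, but the equation for \<open>q\<close> is free of division and holds also where
    \<open>d\<close> vanishes.\<close>
  have cramer: "\<exists>c. (\<forall>k. k \<notin> K \<longrightarrow> c $ Inr k = 0) \<and> c v* pencil A B C D s = state_row l \<and>
      (\<forall>k. poly (q k) s = c $ k * poly d s)" if s: "s \<in> ?S" for s
  proof -
    let ?N = "\<chi> i j. pencil A B C D s $ i $ f j"
    obtain c where c: "\<forall>k. k \<notin> K \<longrightarrow> c $ Inr k = 0" "c v* pencil A B C D s = state_row l"
      using annihilator_in_row_space[where s = s, OF l] s by blast
    have comb: "(\<Sum>i\<in>UNIV. c $ i *s row i ?N) = (\<chi> j. state_row l $ f j)"
      unfolding c(2)[symmetric] by (simp add: vec_eq_iff row_def vector_matrix_mult_def mult.commute)
    have "poly (q k) s = c $ k * poly d s" for k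
    proof -
      have "poly (q k) s = det (\<chi> i. if i = k then (\<Sum>i\<in>UNIV. c $ i *s row i ?N) else row i ?N)"
        unfolding comb q_def poly_det
        by (rule arg_cong[of _ _ det]) (simp add: vec_eq_iff row_def poly_poly_pencil)
      also have "\<dots> = c $ k * det ?N" by (rule cramer_lemma_transpose)
      finally show ?thesis by (simp add: d_def poly_det poly_poly_pencil)
    qed
    then show ?thesis using c by blast
  qed
  have zero: "w = 0" if "\<And>s. s \<in> ?S \<Longrightarrow> poly w s = 0" for w :: "complex poly"
  proof (rule ccontr)
    assume "w \<noteq> 0"
    then have "finite {s. poly w s = 0}" by (rule poly_roots_finite)
    moreover have "?S \<subseteq> {s. poly w s = 0}" using that by blast
    ultimately show False using infinite_stable_reals finite_subset by blast
  qed
  have "q (Inr k) = 0" if "k \<notin> K" for k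
    by (rule zero) (use cramer that in fastforce)
  moreover have "(\<Sum>i\<in>UNIV. q i * ?PP $ i $ j) - d * [:state_row l $ j:] = 0" for j
  proof (rule zero)
    fix s assume "s \<in> ?S"
    then obtain c where c: "c v* pencil A B C D s = state_row l" "\<And>k. poly (q k) s = c $ k * poly d s"
      using cramer by blast
    have "(\<Sum>i\<in>UNIV. poly (q i) s * pencil A B C D s $ i $ j) =
        poly d s * (c v* pencil A B C D s) $ j"
      by (simp add: c(2) vector_matrix_mult_def sum_distrib_left mult_ac)
    then show "poly ((\<Sum>i\<in>UNIV. q i * ?PP $ i $ j) - d * [:state_row l $ j:]) s = 0"
      by (simp add: poly_sum poly_poly_pencil c(1) mult.commute)
  qed
  ultimately show ?thesis
    unfolding row_relation_def using f by (auto simp: d_def[symmetric])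
qed

text \<open>In a relation of minimal degree, a stable root \<open>z\<close> of \<open>d\<close>
  could be divided out: the value of \<open>q\<close> at \<open>z\<close> is a left null vector of
  the pencil there, and it vanishes, either by full rank or because a semisimple zero has no left
  chain of length two.\<close>

lemma row_relation_stable_coprime:
  fixes A :: "real ^ 'n ^ 'n" and B :: "real ^ 'm ^ 'n"
    and C :: "real ^ 'n ^ 'p" and D :: "real ^ 'm ^ 'p"
  assumes ri: "right_invertible A B C D"
    and mult: "\<forall>z \<in> min_phase_zeros td A B C D. zero_alg_mult A B C D z = zero_geom_mult A B C D z"
    and real: "\<forall>z \<in> min_phase_zeros td A B C D. z \<in> \<real>"
    and l: "\<And>x. x \<in> mode_set td A B C D K \<Longrightarrow> l \<bullet> x = 0"
  shows "\<exists>q d. row_relation A B C D K l q d \<and> (\<forall>z\<in>stab_region td. poly d z \<noteq> 0)"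
proof -
  let ?PP = "poly_pencil A B C D" and ?P = "pencil A B C D"
  let ?R = "\<lambda>(q, d). row_relation A B C D K l q d"
  obtain q d where qd: "?R (q, d)" "\<And>q' d'. ?R (q', d') \<Longrightarrow> degree d \<le> degree d'"
  proof -
    obtain x where x: "?R x" using row_relation_exists[OF ri l] by fastforce
    define y where "y = (ARG_MIN (\<lambda>x. degree (snd x)) x. ?R x)"
    have "?R y \<and> (\<forall>x. ?R x \<longrightarrow> degree (snd y) \<le> degree (snd x))"
      unfolding y_def by (rule arg_min_nat_lemma[where P = ?R, OF x])
    then show thesis using that[of "fst y" "snd y"] by fastforce
  qed
  have "poly d z \<noteq> 0" if z: "z \<in> stab_region td" for z
  proof
    assume dz: "poly d z = 0"
    then obtain d1 where d1: "d = [:- z, 1:] * d1" by (auto simp: poly_eq_0_iff_dvd)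
    have "\<exists>r. q i = [:poly (q i) z:] + [:- z, 1:] * r" for i
    proof -
      have "[:- z, 1:] dvd q i - [:poly (q i) z:]" by (simp add: poly_eq_0_iff_dvd[symmetric])
      then show ?thesis unfolding dvd_def by (metis add.commute diff_add_cancel)
    qed
    then obtain q1 where q1: "\<And>i. q i = [:poly (q i) z:] + [:- z, 1:] * q1 i" by metis
    define p where "p = (\<chi> i. poly (q i) z)"
    define tr :: "'n + 'm \<Rightarrow> complex" where "tr = (\<lambda>j. case j of Inl b \<Rightarrow> p $ Inl b | Inr _ \<Rightarrow> 0)"
    have rel: "(\<Sum>i\<in>UNIV. q i * ?PP $ i $ j) = d * [:state_row l $ j:]" for j
      using qd(1) by (auto simp: row_relation_def)
    have rel_at: "(\<Sum>i\<in>UNIV. poly (q i) s * ?P s $ i $ j) = poly d s * state_row l $ j" for s j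
      using arg_cong[OF rel[of j], of "\<lambda>w. poly w s"] by (simp add: poly_sum poly_poly_pencil mult.commute)
    have pP: "p v* ?P z = 0"
      using rel_at[of z] dz by (simp add: vec_eq_iff vector_matrix_mult_def p_def mult.commute)
    have pP_at: "(\<Sum>i\<in>UNIV. p $ i * ?P s $ i $ j) = - (s - z) * tr j" for s j
    proof -
      have "(p v* ?P s) $ j = - (s - z) * tr j"
        by (simp add: row_mult_pencil_shift[of _ A B C D s z] pP tr_def left_diff_distrib)
      then show ?thesis by (simp add: vector_matrix_mult_def mult.commute)
    qed
    \<comment> \<open>Dividing the relation by \<open>X - z\<close> leaves the extra term
      \<open>tr\<close>, because the constant row \<open>p\<close> times the pencil equals
      \<open>- (X - z)\<close> times \<open>tr\<close>.\<close>
    have rel1: "(\<Sum>i\<in>UNIV. q1 i * ?PP $ i $ j) = d1 * [:state_row l $ j:] + [:tr j:]" for j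
    proof -
      have "poly ([:- z, 1:] * (\<Sum>i\<in>UNIV. q1 i * ?PP $ i $ j)) s =
          poly ([:- z, 1:] * (d1 * [:state_row l $ j:] + [:tr j:])) s" for s
      proof -
        have qs: "poly (q i) s = p $ i + (s - z) * poly (q1 i) s" for i
          by (subst q1) (simp add: p_def algebra_simps)
        have "poly d s * state_row l $ j = (\<Sum>i\<in>UNIV. p $ i * ?P s $ i $ j) +
            (s - z) * (\<Sum>i\<in>UNIV. poly (q1 i) s * ?P s $ i $ j)"
          unfolding rel_at[symmetric] qs
          by (simp add: ring_distribs sum.distrib sum_distrib_left sum_subtractf mult_ac)
        then have "(s - z) * (\<Sum>i\<in>UNIV. poly (q1 i) s * ?P s $ i $ j) =
            poly d s * state_row l $ j + (s - z) * tr j"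
          unfolding pP_at by (simp add: algebra_simps)
        moreover have "poly d s = (s - z) * poly d1 s" by (simp add: d1 algebra_simps)
        ultimately have "(s - z) * (\<Sum>i\<in>UNIV. poly (q1 i) s * ?P s $ i $ j) =
            (s - z) * (poly d1 s * state_row l $ j + tr j)"
          by (simp add: algebra_simps)
        then show ?thesis
          unfolding poly_mult poly_sum poly_add poly_poly_pencil by (simp add: algebra_simps)
      qed
      then have "[:- z, 1:] * (\<Sum>i\<in>UNIV. q1 i * ?PP $ i $ j) =
          [:- z, 1:] * (d1 * [:state_row l $ j:] + [:tr j:])"
        by (intro poly_eq_poly_eq_iff[THEN iffD1] ext)
      then show ?thesis by (subst (asm) mult_cancel_left) simp
    qed
    have rel1_at: "(\<Sum>i\<in>UNIV. poly (q1 i) z * ?P z $ i $ j) = poly d1 z * state_row l $ j + tr j" for j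
      using arg_cong[OF rel1[of j], of "\<lambda>w. poly w z"] by (simp add: poly_sum poly_poly_pencil mult.commute)
    have p0: "p = 0"
    proof (cases "rank (?P z) = CARD('n + 'p)")
      case True
      then obtain R :: "complex ^ ('n + 'p) ^ ('n + 'm)" where R: "?P z ** R = mat 1"
        using full_rank_right_inverse by blast
      have "p = p v* (?P z ** R)" by (simp add: R vector_matrix_mul_rid)
      also have "\<dots> = (p v* ?P z) v* R" by (simp add: vector_matrix_mul_assoc)
      also have "\<dots> = 0" by (simp add: pP)
      finally show ?thesis .
    next
      case False
      then have "rank (?P z) < normal_rank A B C D"
        unfolding right_invertible_normal_rank[OF ri] using rank_le_rows[of "?P z"] by linarith
      then have mz: "z \<in> min_phase_zeros td A B C D"
        using z by (simp add: min_phase_zeros_def invariant_zeros_def)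
      then obtain c where c: "c v* ?P z = state_row l"
        using annihilator_in_row_space[OF l z] real by blast
      \<comment> \<open>The zero \<open>z\<close> is real, so \<open>(l, 0)\<close> lies in the row
        space at \<open>z\<close>. Removing its multiple from the value of \<open>q1\<close> leaves
        a row that would continue the chain begun by \<open>p\<close>.\<close>
      define e where "e = (\<chi> i. poly (q1 i) z) - poly d1 z *s c"
      have "(e v* ?P z) $ j = tr j" for j
      proof -
        have "(e v* ?P z) $ j = (\<Sum>i\<in>UNIV. poly (q1 i) z * ?P z $ i $ j)
            - poly d1 z * (c v* ?P z) $ j"
          by (simp add: e_def vector_matrix_mult_def ring_distribs sum_subtractf sum_distrib_left mult_ac)
        then show ?thesis unfolding rel1_at c by simp
      qed
      then have "e v* ?P z = (\<chi> j. case j of Inl b \<Rightarrow> p $ Inl b | Inr _ \<Rightarrow> 0)"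
        by (simp add: vec_eq_iff tr_def)
      then show ?thesis
        using semisimple_zero_no_left_chain[OF ri _ pP] mult mz by blast
    qed
    then have "tr j = 0" for j by (simp add: tr_def split: sum.split)
    moreover have "q1 (Inr k) = 0" if "k \<notin> K" for k
    proof -
      have "q (Inr k) = 0" using qd(1) that by (auto simp: row_relation_def)
      then have "[:- z, 1:] * q1 (Inr k) = 0" using q1[of "Inr k"] by simp
      then show ?thesis by (subst (asm) mult_eq_0_iff) simp
    qed
    moreover have "d1 \<noteq> 0" using qd(1) d1 by (auto simp: row_relation_def)
    ultimately have "?R (q1, d1)"
      by (simp add: row_relation_def rel1)
    then have "degree d \<le> degree d1" by (rule qd(2))
    moreover have "degree d = Suc (degree d1)"
      unfolding d1 using \<open>d1 \<noteq> 0\<close> by (subst degree_mult_eq) auto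
    ultimately show False by simp
  qed
  then show ?thesis using qd(1) by auto
qed

subsection \<open>Output-nulling subspaces lie in the span of modes\<close>

text \<open>
  A functional \<open>g\<close> with \<open>p (M - X) = d g\<close> vanishes: a root \<open>z\<close> of \<open>d\<close> is also a root of all \<open>p y\<close>,
  because \<open>M - z\<close> is surjective, and once \<open>d\<close> is constant a nonzero \<open>p\<close> would have unbounded degree.
\<close>

lemma twisted_functional_zero:
  fixes M :: "complex ^ 'n ^ 'n" and p :: "complex ^ 'n \<Rightarrow> complex poly"
  assumes sub: "\<And>z x. x \<in> W \<Longrightarrow> M *v x - z *s x \<in> W"
    and "\<And>z y. poly d z = 0 \<Longrightarrow> y \<in> W \<Longrightarrow> \<exists>x\<in>W. y = M *v x - z *s x"
    and "\<And>z x. x \<in> W \<Longrightarrow> p (M *v x - z *s x) = p (M *v x) - smult z (p x)"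
    and "\<And>x. x \<in> W \<Longrightarrow> degree (p x) \<le> N"
    and "d \<noteq> 0"
    and "\<And>x. x \<in> W \<Longrightarrow> p (M *v x) - [:0, 1:] * p x = smult (g x) d"
    and "x \<in> W"
  shows "g x = 0"
proof -
  have inv: "M *v x \<in> W" if "x \<in> W" for x
    using sub[OF that, of 0] by simp
  show ?thesis
    using assms(2-)
  proof (induction "degree d" arbitrary: d p)
    case 0
    from 0(1) obtain c where c: "d = [:c:]" using degree_eq_zeroE by metis
    have "p y = 0" if "y \<in> W" for y
    proof (rule ccontr)
      assume y: "p y \<noteq> 0"
      \<comment> \<open>The uniform bound \<open>N\<close> ensures that a maximal degree exists;
        passing from \<open>w\<close> to \<open>M *v w\<close> then raises it by one.\<close>
      define k where "k = (GREATEST k. \<exists>y\<in>W. p y \<noteq> 0 \<and> degree (p y) = k)"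
      have "\<exists>y\<in>W. p y \<noteq> 0 \<and> degree (p y) = k"
        unfolding k_def by (rule GreatestI_nat[of _ "degree (p y)" N]) (use that y 0 in auto)
      then obtain w where w: "w \<in> W" "p w \<noteq> 0" "degree (p w) = k" by blast
      have "p (M *v w) = [:0, 1:] * p w + [:g w * c:]"
        using 0(6)[OF w(1)] by (simp add: c algebra_simps)
      moreover have "degree ([:0, 1:] * p w + [:g w * c:]) = Suc k"
        using w(2,3) by (subst degree_add_eq_left) auto
      ultimately have "p (M *v w) \<noteq> 0" "degree (p (M *v w)) = Suc k" by auto
      then have "Suc k \<le> k"
        unfolding k_def using inv[OF w(1)] 0(4)
        by (intro Greatest_le_nat[where b = N]) (auto intro!: bexI[of _ "M *v w"] simp: k_def)
      then show False by simp
    qed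
    then have "smult (g x) d = 0" using 0(6,7) inv by fastforce
    then show ?case using 0(5) by simp
  next
    case (Suc m)
    have "\<not> constant (poly d)" using Suc(2) by (metis constant_degree nat.distinct(1))
    then obtain z where z: "poly d z = 0" using fundamental_theorem_of_algebra by blast
    then obtain d1 where d1: "d = [:- z, 1:] * d1" by (auto simp: poly_eq_0_iff_dvd)
    have "\<exists>r. p y = [:- z, 1:] * r" if y: "y \<in> W" for y
    proof -
      obtain w where w: "w \<in> W" "y = M *v w - z *s w" using Suc(3)[OF z y] by blast
      have "poly (p y) z = poly (p (M *v w) - [:0, 1:] * p w) z"
        using Suc(4)[OF w(1)] by (simp add: w(2))
      also have "\<dots> = 0" using Suc(7)[OF w(1)] z by simp
      finally show ?thesis unfolding poly_eq_0_iff_dvd dvd_def .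
    qed
    \<comment> \<open>The quotient \<open>p1\<close> is chosen point by point on \<open>W\<close>;
      its properties follow from those of \<open>p\<close> by cancelling the factor
      \<open>X - z\<close>.\<close>
    then obtain p1 where p1: "\<And>y. y \<in> W \<Longrightarrow> p y = [:- z, 1:] * p1 y" by metis
    have cancel: "a = b" if "[:- z, 1:] * a = [:- z, 1:] * b" for a b :: "complex poly"
      using that by (subst (asm) mult_cancel_left) simp
    have d1_nz: "d1 \<noteq> 0" using Suc(6) d1 by auto
    have deg_mult: "degree ([:- z, 1:] * a) = Suc (degree a)" if "a \<noteq> 0" for a :: "complex poly"
      using that by (subst degree_mult_eq) auto
    have sur: "\<exists>w\<in>W. y = M *v w - t *s w" if "poly d1 t = 0" "y \<in> W" for t y
      using Suc(3)[of t y] that by (simp add: d1)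
    show ?case
    proof (rule Suc(1)[of d1 p1])
      show "m = degree d1" using Suc(2) deg_mult[OF d1_nz] d1 by simp
      fix y t assume y: "y \<in> W"
      show "p1 (M *v y - t *s y) = p1 (M *v y) - smult t (p1 y)"
        using Suc(4)[OF y, of t] unfolding p1[OF y] p1[OF inv[OF y]] p1[OF sub[OF y]]
        by - (rule cancel, simp only: right_diff_distrib mult_smult_right)
      show "degree (p1 y) \<le> N"
        using Suc(5)[OF y] p1[OF y] deg_mult[of "p1 y"] by (cases "p1 y = 0") auto
      show "p1 (M *v y) - [:0, 1:] * p1 y = smult (g y) d1"
        using Suc(7)[OF y] unfolding p1[OF y] p1[OF inv[OF y]] d1
        by - (rule cancel, simp only: right_diff_distrib mult_smult_right mult.left_commute)
    qed (use sur d1_nz Suc(8) in auto)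
  qed
qed


section \<open>Complexification of real matrices and invariant subspaces\<close>

lemma complex_mat_mult_vec_parts:
  fixes M :: "real ^ 'n ^ 'k"
  shows "(\<chi> i. Re ((complex_mat M *v x) $ i)) = M *v (\<chi> i. Re (x $ i))"
    and "(\<chi> i. Im ((complex_mat M *v x) $ i)) = M *v (\<chi> i. Im (x $ i))"
  by (simp_all add: vec_eq_iff matrix_vector_mult_def complex_mat_def)

lemma complex_mat_mult_vec_eq_0:
  fixes M :: "real ^ 'n ^ 'k"
  assumes "(M *v (\<chi> i. Re (x $ i))) $ k = 0" "(M *v (\<chi> i. Im (x $ i))) $ k = 0"
  shows "(complex_mat M *v x) $ k = 0"
  using assms by (simp add: complex_eq_iff flip: complex_mat_mult_vec_parts)

lemma complex_mat_closed_loop: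
  fixes A :: "real ^ 'n ^ 'k" and B :: "real ^ 'm ^ 'k" and F :: "real ^ 'n ^ 'm"
  shows "complex_mat (A + B ** F) *v x = complex_mat A *v x + complex_mat B *v (complex_mat F *v x)"
proof -
  have "complex_mat (A + B ** F) = complex_mat A + complex_mat B ** complex_mat F"
    by (simp add: vec_eq_iff complex_mat_def matrix_matrix_mult_def)
  then show ?thesis
    by (simp add: matrix_vector_mult_add_rdistrib matrix_vector_mul_assoc)
qed

text \<open>\<open>W V\<close> is the complexification of \<open>V\<close>. Off the spectrum
  \<open>M - z\<close> is injective on it, hence surjective by counting dimensions over the
  reals.\<close>

lemma shifted_matrix_surj_on:
  fixes M :: "real ^ 'n ^ 'n"
  defines "W V \<equiv> {x :: complex ^ 'n. (\<chi> i. Re (x $ i)) \<in> V \<and> (\<chi> i. Im (x $ i)) \<in> V}"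
  assumes V: "subspace V" "(\<lambda>x. M *v x) ` V \<subseteq> V"
  shows "x \<in> W V \<Longrightarrow> complex_mat M *v x - z *s x \<in> W V"
    and "z \<notin> spectrum_on M V \<Longrightarrow> y \<in> W V \<Longrightarrow> \<exists>x\<in>W V. y = complex_mat M *v x - z *s x"
proof -
  let ?T = "\<lambda>z x. complex_mat M *v x - z *s x"
  have T: "?T z x \<in> W V" if x: "x \<in> W V" for x z
  proof -
    let ?a = "\<chi> i. Re (x $ i)" and ?b = "\<chi> i. Im (x $ i)"
    have "(\<chi> i. Re (?T z x $ i)) = (\<chi> i. Re ((complex_mat M *v x) $ i)) - (Re z *\<^sub>R ?a - Im z *\<^sub>R ?b)"
      "(\<chi> i. Im (?T z x $ i)) = (\<chi> i. Im ((complex_mat M *v x) $ i)) - (Re z *\<^sub>R ?b + Im z *\<^sub>R ?a)"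
      by (simp_all add: vec_eq_iff)
    then show "?T z x \<in> W V"
      using x V unfolding W_def complex_mat_mult_vec_parts
      by (auto intro!: subspace_diff subspace_add subspace_scale)
  qed
  then show "x \<in> W V \<Longrightarrow> ?T z x \<in> W V" .
  have subW: "subspace (W V)"
  proof -
    have "W V = (\<lambda>x. \<chi> i. Re (x $ i)) -` V \<inter> (\<lambda>x. \<chi> i. Im (x $ i)) -` V"
      by (auto simp: W_def)
    moreover have "linear (\<lambda>x :: complex ^ 'n. \<chi> i. Re (x $ i))" "linear (\<lambda>x :: complex ^ 'n. \<chi> i. Im (x $ i))"
      by (auto intro!: linearI simp: vec_eq_iff)
    ultimately show ?thesis
      using V(1) by (simp add: subspace_Int linear_subspace_vimage subspace_inter)
  qed
  assume z: "z \<notin> spectrum_on M V" and y: "y \<in> W V"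
  have lin: "linear (?T z)"
    by (auto intro!: linearI simp: vec_eq_iff matrix_vector_mult_def algebra_simps sum.distrib
        scaleR_sum_right)
  have "inj_on (?T z) (W V)"
    unfolding linear_inj_on_iff_eq_0[OF lin subW] using z by (auto simp: spectrum_on_def W_def)
  then have "dim (?T z ` W V) = dim (W V)"
    using dim_image_eq[OF lin, of "W V"] subW by (simp add: span_eq_iff[THEN iffD2])
  then have "dim (W V) \<le> dim (?T z ` W V)" by simp
  moreover have "?T z ` W V \<subseteq> W V" using T by blast
  ultimately have "?T z ` W V = W V"
    using subspace_dim_equal[OF linear_subspace_image[OF lin subW] subW] by blast
  then have "y \<in> ?T z ` W V" using y by simp
  then show "\<exists>x\<in>W V. y = ?T z x" by blast
qed

text \<open>The relation, applied to the stacked vector of \<open>x\<close> and \<open>F x\<close>,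
  becomes a polynomial relation for the closed-loop map alone. The roots of \<open>d\<close> are not
  stable, so they avoid the spectrum on \<open>V\<close>.\<close>

lemma row_relation_annihilates:
  fixes A :: "real ^ 'n ^ 'n" and B :: "real ^ 'm ^ 'n"
    and C :: "real ^ 'n ^ 'p" and D :: "real ^ 'm ^ 'p"
  assumes rel: "row_relation A B C D K l q d"
    and d: "\<And>z. z \<in> stab_region td \<Longrightarrow> poly d z \<noteq> 0"
    and V: "stab_output_nulling td A B C D K V" "v \<in> V"
  shows "l \<bullet> v = 0"
proof -
  obtain F :: "real ^ 'n ^ 'm" where sV: "subspace V"
    and F: "(\<lambda>x. (A + B ** F) *v x) ` V \<subseteq> V"
      "V \<subseteq> {x. \<forall>k\<in>K. ((C + D ** F) *v x) $ k = 0}"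
      "spectrum_on (A + B ** F) V \<subseteq> stab_region td"
    using V(1) unfolding stab_output_nulling_def by blast
  define W where "W = {x :: complex ^ 'n. (\<chi> i. Re (x $ i)) \<in> V \<and> (\<chi> i. Im (x $ i)) \<in> V}"
  define M where "M = complex_mat (A + B ** F)"
  define p where "p = (\<lambda>x :: complex ^ 'n. \<Sum>a\<in>UNIV. smult (x $ a) (q (Inl a)))"
  define g where "g = (\<lambda>x :: complex ^ 'n. \<Sum>b\<in>UNIV. complex_of_real (l $ b) * x $ b)"
  have main: "p (M *v x) - [:0, 1:] * p x = smult (g x) d" if x: "x \<in> W" for x
  proof -
    have "poly (p (M *v x) - [:0, 1:] * p x) s = poly (smult (g x) d) s" for s
    proof -
      define z where "z = (\<chi> j. case j of Inl b \<Rightarrow> x $ b | Inr c \<Rightarrow> (complex_mat F *v x) $ c)"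
      let ?P = "pencil A B C D s"
      have "(\<Sum>i\<in>UNIV. poly (q i) s * ?P $ i $ j) = poly d s * state_row l $ j" for j
      proof -
        have "(\<Sum>i\<in>UNIV. q i * poly_pencil A B C D $ i $ j) = d * [:state_row l $ j:]"
          using rel by (auto simp: row_relation_def)
        from arg_cong[OF this, of "\<lambda>w. poly w s"] show ?thesis
          by (simp add: poly_sum poly_poly_pencil mult.commute)
      qed
      then have "(\<Sum>j\<in>UNIV. (\<Sum>i\<in>UNIV. poly (q i) s * ?P $ i $ j) * z $ j) =
          (\<Sum>j\<in>UNIV. poly d s * state_row l $ j * z $ j)" by simp
      also have "\<dots> = poly d s * g x"
        by (simp add: sum_UNIV_Plus state_row_def z_def g_def sum_distrib_left mult_ac)
      also have "(\<Sum>j\<in>UNIV. (\<Sum>i\<in>UNIV. poly (q i) s * ?P $ i $ j) * z $ j) =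
          (\<Sum>i\<in>UNIV. poly (q i) s * (?P *v z) $ i)"
        unfolding sum_distrib_right matrix_vector_mult_def vec_lambda_beta sum_distrib_left
        by (subst sum.swap) (simp add: mult_ac)
      also have "\<dots> = (\<Sum>a\<in>UNIV. poly (q (Inl a)) s * ((M *v x) $ a - s * x $ a))"
      proof -
        have "(?P *v z) $ Inl a = (M *v x) $ a - s * x $ a" for a
          unfolding M_def complex_mat_closed_loop
          by (simp add: matrix_vector_mult_def sum_UNIV_Plus pencil_def pencil_over_def z_def
              complex_mat_def left_diff_distrib sum_subtractf mult_delta_left)
        \<comment> \<open>Outputs in \<open>K\<close> vanish on \<open>V\<close>, and the other
          output rows have coefficient zero.\<close>
        moreover have "poly (q (Inr k)) s * (?P *v z) $ Inr k = 0" for k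
        proof (cases "k \<in> K")
          case True
          have "(?P *v z) $ Inr k = (complex_mat (C + D ** F) *v x) $ k"
            unfolding complex_mat_closed_loop
            by (simp add: matrix_vector_mult_def sum_UNIV_Plus pencil_def pencil_over_def z_def
                complex_mat_def)
          also have "\<dots> = 0"
            using F(2) x True by (intro complex_mat_mult_vec_eq_0) (auto simp: W_def)
          finally show ?thesis by simp
        next
          case False
          then show ?thesis using rel by (simp add: row_relation_def)
        qed
        ultimately show ?thesis
          by (simp only: sum_UNIV_Plus sum.neutral_const add.right_neutral)
      qed
      finally show ?thesis
        by (simp add: p_def poly_sum algebra_simps sum_subtractf sum_distrib_left)
    qed
    then show ?thesis by (intro poly_eq_poly_eq_iff[THEN iffD1] ext)
  qed
  have zero: "g x = 0" if "x \<in> W" for x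
  proof (rule twisted_functional_zero[where W = W and M = M and d = d and p = p and g = g])
    show "M *v x - z *s x \<in> W" if "x \<in> W" for x z
      using shifted_matrix_surj_on(1)[OF sV F(1)] that unfolding W_def M_def by blast
    show "\<exists>x\<in>W. y = M *v x - z *s x" if "poly d z = 0" "y \<in> W" for z y
      using shifted_matrix_surj_on(2)[OF sV F(1), of z y] that d[of z] F(3) unfolding W_def M_def by blast
    show "p (M *v x - z *s x) = p (M *v x) - smult z (p x)" for x z
      by (simp add: p_def poly_eq_iff coeff_sum left_diff_distrib right_diff_distrib sum_subtractf sum_distrib_left mult_ac)
    show "degree (p x) \<le> (MAX a. degree (q (Inl a)))" for x
      unfolding p_def by (intro degree_sum_le) (auto intro: order_trans[OF degree_smult_le])
    show "x \<in> W" by (rule that)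
    show "p (M *v x) - [:0, 1:] * p x = smult (g x) d" if "x \<in> W" for x
      using that by (rule main)
    show "d \<noteq> 0" using rel by (simp add: row_relation_def)
  qed
  let ?v = "\<chi> i. complex_of_real (v $ i)"
  have "?v \<in> W" using V(2) sV by (simp add: W_def vec_lambda_eta subspace_0 flip: zero_vec_def)
  then have "complex_of_real (l \<bullet> v) = 0"
    using zero[of ?v] by (simp add: g_def inner_vec_def)
  then show ?thesis by simp
qed

text \<open>The component \<open>l\<close> of \<open>x\<close> orthogonal to the span annihilates
  the modes, hence all of \<open>V\<close> and in particular \<open>x\<close>; so \<open>l\<close>
  is orthogonal to itself.\<close>

lemma stab_output_nulling_subset_span:
  fixes A :: "real ^ 'n ^ 'n" and B :: "real ^ 'm ^ 'n"
    and C :: "real ^ 'n ^ 'p" and D :: "real ^ 'm ^ 'p"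
  assumes ri: "right_invertible A B C D"
    and mult: "\<forall>z \<in> min_phase_zeros td A B C D. zero_alg_mult A B C D z = zero_geom_mult A B C D z"
    and real: "\<forall>z \<in> min_phase_zeros td A B C D. z \<in> \<real>"
    and V: "stab_output_nulling td A B C D K V"
  shows "V \<subseteq> span (mode_set td A B C D K)"
proof
  fix x assume x: "x \<in> V"
  obtain y l where yl: "y \<in> span (mode_set td A B C D K)"
      "\<And>w. w \<in> span (mode_set td A B C D K) \<Longrightarrow> orthogonal l w" "x = y + l"
    using orthogonal_subspace_decomp_exists by blast
  have l: "l \<bullet> w = 0" if "w \<in> mode_set td A B C D K" for w
    using yl(2) that by (simp add: span_base orthogonal_def)
  obtain q d where "row_relation A B C D K l q d" "\<forall>z\<in>stab_region td. poly d z \<noteq> 0"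
    using row_relation_stable_coprime[OF ri mult real l] by blast
  then have "l \<bullet> x = 0"
    using row_relation_annihilates V x by blast
  moreover have "l \<bullet> y = 0" using yl(1,2) by (simp add: orthogonal_def)
  ultimately have "l = 0" using yl(3) by (simp add: inner_add_right)
  then show "x \<in> span (mode_set td A B C D K)" using yl by simp
qed

subsection \<open>Eigenbases and the largest output-nulling subspace\<close>

lemma dual_basis_exists:
  fixes S :: "'a::euclidean_space set"
  assumes "independent S"
  obtains f :: "'a \<Rightarrow> 'a \<Rightarrow> real" where "\<And>t. linear (f t)"
    "\<And>t b. t \<in> S \<Longrightarrow> b \<in> S \<Longrightarrow> f t b = (if b = t then 1 else 0)"
    "\<And>w. w \<in> span S \<Longrightarrow> w = (\<Sum>t\<in>S. f t w *\<^sub>R t)"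
proof -
  have "\<exists>g. linear g \<and> (\<forall>b\<in>S. g b = (if b = t then 1 else 0 :: real))" for t
    by (rule linear_independent_extend[OF assms])
  then obtain f :: "'a \<Rightarrow> 'a \<Rightarrow> real" where lin: "\<And>t. linear (f t)"
    and f: "\<And>t b. b \<in> S \<Longrightarrow> f t b = (if b = t then 1 else 0)" by metis
  have fin: "finite S" using assms by (rule finiteI_independent)
  have "w = (\<Sum>t\<in>S. f t w *\<^sub>R t)" if "w \<in> span S" for w
  proof (rule linear_eq_on_span[OF _ _ _ that])
    show "linear (\<lambda>w. w)" by (rule linear_id[unfolded id_def])
    show "linear (\<lambda>w. \<Sum>t\<in>S. f t w *\<^sub>R t)"
      by (intro linear_compose_sum ballI linearI)
        (simp_all add: linear_add[OF lin] linear_scale[OF lin] scaleR_add_left)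
    show "b = (\<Sum>t\<in>S. f t b *\<^sub>R t)" if "b \<in> S" for b
    proof -
      have "(\<Sum>t\<in>S. f t b *\<^sub>R t) = (\<Sum>t\<in>S. if b = t then t else 0)"
        using that by (intro sum.cong) (auto simp: f)
      then show ?thesis using that fin by simp
    qed
  qed
  then show thesis using that[of f] lin f by blast
qed

text \<open>A coordinate functional of an eigenbasis is a left eigenvector.\<close>

lemma eigenbasis_coordinate:
  fixes M :: "real ^ 'n ^ 'n"
  assumes f: "linear f" "\<And>b. b \<in> S \<Longrightarrow> f b = (if b = t then 1 else 0 :: real)"
    and M: "\<And>b. b \<in> S \<Longrightarrow> M *v b = lam b *s b" and w: "w \<in> span S"
  shows "f (M *v w) = lam t * f w"
proof (rule linear_eq_on_span[OF _ _ _ w])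
  show "linear (\<lambda>w. f (M *v w))"
    using linear_compose[OF matrix_vector_mul_linear f(1)] by (simp add: o_def)
  show "linear (\<lambda>w. lam t * f w)"
    using linear_compose_scale_right[OF f(1), of "lam t"] by simp
  show "f (M *v b) = lam t * f b" if "b \<in> S" for b
    using that by (simp add: M scalar_mult_eq_scaleR linear_scale[OF f(1)] f(2))
qed

text \<open>Some coordinate of a complex eigenvector is nonzero. Applying that coordinate functional
  to its real and imaginary parts forces the eigenvalue to be the one of that coordinate.\<close>

lemma spectrum_on_span_eigenbasis:
  fixes M :: "real ^ 'n ^ 'n"
  assumes ind: "independent S"
    and M: "\<And>b. b \<in> S \<Longrightarrow> M *v b = lam b *s b"
    and R: "\<And>b. b \<in> S \<Longrightarrow> complex_of_real (lam b) \<in> R"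
  shows "spectrum_on M (span S) \<subseteq> R"
proof
  fix s assume "s \<in> spectrum_on M (span S)"
  then obtain v where v: "v \<noteq> 0" "(\<chi> i. Re (v $ i)) \<in> span S" "(\<chi> i. Im (v $ i)) \<in> span S"
    "complex_mat M *v v = s *s v" unfolding spectrum_on_def by blast
  define a b where "a = (\<chi> i. Re (v $ i))" and "b = (\<chi> i. Im (v $ i))"
  have Mab: "M *v a = Re s *\<^sub>R a - Im s *\<^sub>R b" "M *v b = Re s *\<^sub>R b + Im s *\<^sub>R a"
    unfolding a_def b_def complex_mat_mult_vec_parts[symmetric] v(4) by (simp_all add: vec_eq_iff)
  obtain f :: "real ^ 'n \<Rightarrow> real ^ 'n \<Rightarrow> real" where f: "\<And>t. linear (f t)"
    "\<And>t b. t \<in> S \<Longrightarrow> b \<in> S \<Longrightarrow> f t b = (if b = t then 1 else 0)"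
    "\<And>w. w \<in> span S \<Longrightarrow> w = (\<Sum>t\<in>S. f t w *\<^sub>R t)"
    using dual_basis_exists[OF ind] by blast
  have "\<exists>t\<in>S. f t a \<noteq> 0 \<or> f t b \<noteq> 0"
  proof (rule ccontr)
    assume "\<not> ?thesis"
    then have "a = 0" "b = 0" using f(3)[of a] f(3)[of b] v(2,3) by (auto simp: a_def b_def)
    then have "v = 0" by (simp add: vec_eq_iff a_def b_def complex_eq_iff)
    then show False using v(1) by simp
  qed
  then obtain t where t: "t \<in> S" "Complex (f t a) (f t b) \<noteq> 0" by (auto simp: complex_eq_iff)
  have "f t (M *v w) = lam t * f t w" if "w \<in> span S" for w
    by (rule eigenbasis_coordinate[OF f(1) _ M that]) (use t f(2) in auto)
  then have "lam t * f t a = Re s * f t a - Im s * f t b" "lam t * f t b = Re s * f t b + Im s * f t a"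
    using v(2,3) Mab unfolding a_def[symmetric] b_def[symmetric]
    by (metis linear_diff[OF f(1)] linear_add[OF f(1)] linear_scale[OF f(1)] real_scaleR_def)+
  then have "complex_of_real (lam t) * Complex (f t a) (f t b) = s * Complex (f t a) (f t b)"
    by (simp add: complex_eq_iff)
  then have "s = complex_of_real (lam t)" using t(2) by simp
  then show "s \<in> R" using R t(1) by simp
qed

lemma feedback_on_basis_exists:
  fixes u :: "real ^ 'n \<Rightarrow> real ^ 'm"
  assumes "independent S"
  shows "\<exists>F :: real ^ 'n ^ 'm. \<forall>b\<in>S. F *v b = u b"
proof -
  obtain g where "linear g" "\<forall>b\<in>S. g b = u b"
    using linear_independent_extend[OF assms, of u] by metis
  then show ?thesis by (intro exI[of _ "matrix g"]) (simp add: matrix_works)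
qed

lemma matrix_vector_mult_closed_loop:
  "((A :: real ^ 'n ^ 'k) + B ** F) *v x = A *v x + B *v (F *v x)"
  by (simp add: matrix_vector_mult_add_rdistrib matrix_vector_mul_assoc)

text \<open>A basis of the span can be chosen among the modes themselves. One feedback realises
  their inputs at once, even though the eigenvalues differ from vector to vector.\<close>

lemma stab_output_nulling_span_mode_set:
  "stab_output_nulling td A B C D K (span (mode_set td A B C D K))"
proof -
  let ?E = "mode_set td A B C D K"
  obtain S where S: "S \<subseteq> ?E" "independent S" "?E \<subseteq> span S"
    using maximal_independent_subset by blast
  have span_S: "span S = span ?E"
    using S(1,3) by (metis span_mono span_span subset_antisym)
  have "\<forall>b\<in>S. \<exists>lam u. complex_of_real lam \<in> stab_region td \<and>
     A *v b + B *v u = lam *s b \<and> (\<forall>k\<in>K. (C *v b + D *v u) $ k = 0)"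
    using S(1) unfolding mode_set_def by blast
  then obtain lam u where lu: "\<And>b. b \<in> S \<Longrightarrow> complex_of_real (lam b) \<in> stab_region td"
    "\<And>b. b \<in> S \<Longrightarrow> A *v b + B *v u b = lam b *s b"
    "\<And>b k. b \<in> S \<Longrightarrow> k \<in> K \<Longrightarrow> (C *v b + D *v u b) $ k = 0"
    by metis
  obtain F where F: "\<And>b. b \<in> S \<Longrightarrow> F *v b = u b"
    using feedback_on_basis_exists[OF S(2)] by blast
  have eig: "(A + B ** F) *v b = lam b *s b" if "b \<in> S" for b
    using that by (simp add: matrix_vector_mult_closed_loop F lu(2))
  have "(\<lambda>x. (A + B ** F) *v x) ` span S = span ((\<lambda>x. (A + B ** F) *v x) ` S)"
    by (rule linear_span_image[symmetric]) (rule matrix_vector_mul_linear)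
  also have "\<dots> \<subseteq> span S"
    by (rule span_minimal) (auto simp: eig scalar_mult_eq_scaleR intro: span_base span_scale)
  finally have inv: "(\<lambda>x. (A + B ** F) *v x) ` span S \<subseteq> span S" .
  have "subspace {x. \<forall>k\<in>K. ((C + D ** F) *v x) $ k = 0}"
    by (auto simp: subspace_def matrix_vector_right_distrib matrix_vector_mult_scaleR)
  then have "span S \<subseteq> {x. \<forall>k\<in>K. ((C + D ** F) *v x) $ k = 0}"
    by (intro span_minimal) (use F lu(3) in \<open>auto simp: matrix_vector_mult_closed_loop\<close>)
  moreover have "spectrum_on (A + B ** F) (span S) \<subseteq> stab_region td"
    using spectrum_on_span_eigenbasis[OF S(2) eig lu(1)] .
  ultimately show ?thesis
    unfolding stab_output_nulling_def span_S[symmetric] using inv by blast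
qed

text \<open>The order behind \<open>GREATEST\<close> is inclusion: the span is itself admissible and
  contains every admissible subspace.\<close>

lemma largest_stab_output_nulling_eq_span:
  fixes A :: "real ^ 'n ^ 'n" and B :: "real ^ 'm ^ 'n"
    and C :: "real ^ 'n ^ 'p" and D :: "real ^ 'm ^ 'p"
  assumes "right_invertible A B C D"
    and "\<forall>z \<in> min_phase_zeros td A B C D. zero_alg_mult A B C D z = zero_geom_mult A B C D z"
    and "\<forall>z \<in> min_phase_zeros td A B C D. z \<in> \<real>"
  shows "largest_stab_output_nulling td A B C D K = span (mode_set td A B C D K)"
  unfolding largest_stab_output_nulling_def
  by (rule Greatest_equality)
    (auto intro: stab_output_nulling_span_mode_set dest: stab_output_nulling_subset_span[OF assms])

subsection \<open>Independent transversals\<close>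

text \<open>
  The set \<open>U\<close> plays the role of a contraction: it avoids quotient spaces in the induction.
\<close>

lemma Rado_transversal_over:
  fixes E :: "'i \<Rightarrow> 'a::euclidean_space set"
  assumes "finite I"
    and "\<And>J. J \<subseteq> I \<Longrightarrow> dim U + card J \<le> dim (U \<union> \<Union> (E ` J))"
  shows "\<exists>e. (\<forall>i\<in>I. e i \<in> E i) \<and> dim U + card I \<le> dim (U \<union> e ` I)"
  using assms
proof (induction I arbitrary: U rule: finite_psubset_induct)
  case (psubset I)
  \<comment> \<open>If a proper nonempty subfamily satisfies the condition with equality, it and the
    remainder are solved in turn. Otherwise all of them have slack, and one vector can be chosen
    freely outside \<open>span U\<close>.\<close>
  consider "I = {}" | (tight) J where "J \<subset> I" "J \<noteq> {}" "dim (U \<union> \<Union> (E ` J)) \<le> dim U + card J"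
    | (loose) "I \<noteq> {}" "\<And>J. J \<subset> I \<Longrightarrow> J \<noteq> {} \<Longrightarrow> dim U + card J < dim (U \<union> \<Union> (E ` J))"
    using not_le by blast
  then show ?case
  proof cases
    case 1
    then show ?thesis by simp
  next
    case tight
    have fin: "finite J" using tight(1) psubset(1) finite_subset by blast
    obtain e1 where e1: "\<forall>i\<in>J. e1 i \<in> E i" "dim U + card J \<le> dim (U \<union> e1 ` J)"
    proof -
      have "dim U + card L \<le> dim (U \<union> \<Union> (E ` L))" if "L \<subseteq> J" for L
        using that tight(1) by (intro psubset(3)) auto
      from psubset(2)[OF tight(1) this] obtain e where
        "\<forall>i\<in>J. e i \<in> E i" "dim U + card J \<le> dim (U \<union> e ` J)" by metis
      then show thesis by (rule that)
    qed
    define U' where "U' = U \<union> \<Union> (E ` J)"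
    have IJ: "I - J \<subset> I" using tight(1,2) by blast
    have dim_U': "dim U' = dim U + card J"
      using tight(3) psubset(3)[of J] tight(1) unfolding U'_def by fastforce
    \<comment> \<open>The condition for \<open>J \<union> L\<close>, less the equality for
      \<open>J\<close>, is the condition for \<open>L\<close> over \<open>U'\<close>.\<close>
    have "dim U' + card L \<le> dim (U' \<union> \<Union> (E ` L))" if L: "L \<subseteq> I - J" for L
    proof -
      have "finite L" using L psubset(1) finite_subset by blast
      then have "card (J \<union> L) = card J + card L"
        using L fin by (intro card_Un_disjoint) auto
      moreover have "dim U + card (J \<union> L) \<le> dim (U \<union> \<Union> (E ` (J \<union> L)))"
        using L tight(1) by (intro psubset(3)) auto
      moreover have "U \<union> \<Union> (E ` (J \<union> L)) = U' \<union> \<Union> (E ` L)" by (auto simp: U'_def)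
      ultimately show ?thesis using dim_U' by simp
    qed
    from psubset(2)[OF IJ this] obtain e2 where e2: "\<forall>i\<in>I - J. e2 i \<in> E i"
        "dim U' + card (I - J) \<le> dim (U' \<union> e2 ` (I - J))"
      by metis
    \<comment> \<open>Dimensions agree by tightness, so the chosen vectors can replace the whole
      sets of the family \<open>J\<close>.\<close>
    have "span (U \<union> e1 ` J) = span U'"
      using e1 dim_U' by (intro dim_eq_span) (auto simp: U'_def)
    then have "U' \<subseteq> span (U \<union> e1 ` J)" using span_superset by blast
    also have "\<dots> \<subseteq> span (U \<union> e1 ` J \<union> e2 ` (I - J))" by (rule span_mono) simp
    finally have "U' \<union> e2 ` (I - J) \<subseteq> span (U \<union> e1 ` J \<union> e2 ` (I - J))"
      by (auto intro: span_base)
    then have "dim (U' \<union> e2 ` (I - J)) \<le> dim (U \<union> e1 ` J \<union> e2 ` (I - J))"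
      by (rule dim_mono)
    moreover have "U \<union> (\<lambda>i. if i \<in> J then e1 i else e2 i) ` I = U \<union> e1 ` J \<union> e2 ` (I - J)"
      using tight(1) by (auto simp: image_iff)
    moreover have "card (I - J) + card J = card I"
      using tight(1) fin psubset(1) by (simp add: card_Diff_subset card_mono psubset_imp_subset)
    ultimately have "dim U + card I \<le> dim (U \<union> (\<lambda>i. if i \<in> J then e1 i else e2 i) ` I)"
      using e2(2) dim_U' by simp
    moreover have "\<forall>i\<in>I. (if i \<in> J then e1 i else e2 i) \<in> E i" using e1(1) e2(1) by simp
    ultimately show ?thesis
      by (intro exI[of _ "\<lambda>i. if i \<in> J then e1 i else e2 i"] conjI)
  next
    case loose
    then obtain i where i: "i \<in> I" by blast
    have "\<not> E i \<subseteq> span U"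
    proof
      assume "E i \<subseteq> span U"
      then have "dim (U \<union> E i) \<le> dim U" by (intro dim_mono) (auto intro: span_base)
      then show False using psubset(3)[of "{i}"] i by simp
    qed
    then obtain x where x: "x \<in> E i" "x \<notin> span U" by blast
    have Ii: "I - {i} \<subset> I" using i by blast
    have dim_U': "dim (insert x U) = dim U + 1" using x(2) by (simp add: dim_insert)
    \<comment> \<open>The slack of one pays for the dimension that \<open>x\<close> adds to
      \<open>U\<close>.\<close>
    have "dim (insert x U) + card J \<le> dim (insert x U \<union> \<Union> (E ` J))" if J: "J \<subseteq> I - {i}" for J
    proof (cases "J = {}")
      case False
      have "J \<subset> I" using J i by blast
      from loose(2)[OF this False] have "dim U + card J + 1 \<le> dim (U \<union> \<Union> (E ` J))" by simp
      also have "\<dots> \<le> dim (insert x U \<union> \<Union> (E ` J))" by (rule dim_subset) auto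
      finally show ?thesis using dim_U' by simp
    qed simp
    from psubset(2)[OF Ii this] obtain e where e: "\<forall>j\<in>I - {i}. e j \<in> E j"
        "dim (insert x U) + card (I - {i}) \<le> dim (insert x U \<union> e ` (I - {i}))"
      by metis
    have "dim (insert x U \<union> e ` (I - {i})) \<le> dim (U \<union> (e(i := x)) ` I)"
      using i by (intro dim_subset) auto
    moreover have "card I = Suc (card (I - {i}))"
      using psubset(1) i by (rule card.remove)
    ultimately have "dim U + card I \<le> dim (U \<union> (e(i := x)) ` I)"
      using e(2) dim_U' by linarith
    moreover have "\<forall>j\<in>I. (e(i := x)) j \<in> E j" using e(1) x(1) by simp
    ultimately show ?thesis by (intro exI[of _ "e(i := x)"] conjI)
  qed
qed

text \<open>With nothing contracted, the chosen vectors span dimension at least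
  \<open>card I\<close>, which excludes both repetitions and linear dependence.\<close>

lemma Rado_transversal:
  fixes E :: "'i \<Rightarrow> 'a::euclidean_space set"
  assumes fin: "finite I"
    and "\<And>J. J \<subseteq> I \<Longrightarrow> card J \<le> dim (\<Union> (E ` J))"
  obtains e where "\<And>i. i \<in> I \<Longrightarrow> e i \<in> E i" "inj_on e I" "independent (e ` I)"
proof -
  obtain e where e: "\<forall>i\<in>I. e i \<in> E i" "card I \<le> dim (e ` I)"
    using Rado_transversal_over[OF fin, of "{}" E] assms(2) by auto
  have "dim (e ` I) \<le> card (e ` I)" by (rule dim_le_card'[OF finite_imageI[OF fin]])
  moreover have "card (e ` I) \<le> card I" using fin by (rule card_image_le)
  ultimately have "card (e ` I) = card I" "card (e ` I) = dim (e ` I)" using e(2) by auto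
  then show thesis
    using that[of e] e(1) eq_card_imp_inj_on[OF fin] card_eq_dim[of "e ` I" "e ` I"] fin
    by (auto intro: span_base)
qed

subsection \<open>Tracking\<close>

lemma real_eigenvalue_in_spectrum:
  fixes M :: "real ^ 'n ^ 'n"
  assumes "M *v x = a *s x" "x \<noteq> 0"
  shows "complex_of_real a \<in> spectrum M"
proof -
  let ?x = "\<chi> i. complex_of_real (x $ i)"
  have "(complex_mat M *v ?x) $ i = complex_of_real ((M *v x) $ i)" for i
    by (simp add: matrix_vector_mult_def complex_mat_def)
  then have "complex_mat M *v ?x = complex_of_real a *s ?x"
    unfolding assms(1) by (simp add: vec_eq_iff)
  moreover have "?x \<noteq> 0" using assms(2) by (simp add: vec_eq_iff)
  ultimately show ?thesis unfolding spectrum_on_def by blast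
qed

lemma shifted_matrix_mult_vec: "(mat a - M) *v x = a *s x - M *v x"
  for M :: "real ^ 'n ^ 'n"
  by (simp add: matrix_vector_mult_diff_rdistrib)
    (simp add: vec_eq_iff mat_def matrix_vector_mult_def mult_delta_left)

lemma dc_point_not_stable: "dc_point td \<notin> stab_region td"
  by (cases td) auto

lemma of_real_dc_point: "complex_of_real (dc_point td) = dc_point td"
  by (cases td) auto

lemma closed_loop_dc_invertible:
  fixes M :: "real ^ 'n ^ 'n"
  assumes "spectrum M \<subseteq> stab_region td"
  shows "invertible (mat (dc_point td) - M)"
  unfolding invertible_left_inverse matrix_left_invertible_ker
proof (intro allI impI)
  fix x assume "(mat (dc_point td) - M) *v x = 0"
  then have "M *v x = dc_point td *s x"
    by (simp add: shifted_matrix_mult_vec)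
  then show "x = 0"
    using real_eigenvalue_in_spectrum[of M x] assms dc_point_not_stable of_real_dc_point by (metis subsetD)
qed

lemma matrix_inv_inverse:
  assumes "invertible (M :: real ^ 'n ^ 'n)"
  shows "M ** matrix_inv M = mat 1" "matrix_inv M ** M = mat 1"
proof -
  have "\<exists>N. M ** N = mat 1 \<and> N ** M = mat 1" using assms by (simp add: invertible_def)
  from someI_ex[OF this] show "M ** matrix_inv M = mat 1" "matrix_inv M ** M = mat 1"
    by (simp_all add: matrix_inv_def)
qed

lemma static_gain_mult_vec:
  "static_gain td A B C D F *v u =
    (C + D ** F) *v (matrix_inv (mat (dc_point td) - (A + B ** F)) *v (B *v u)) + D *v u"
  by (simp add: static_gain_def matrix_vector_mult_add_rdistrib matrix_vector_mul_assoc
      matrix_mul_assoc)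

text \<open>The dc point is no zero, so the pencil is surjective there and yields a steady state and
  input with any prescribed output.\<close>

lemma static_gain_right_inverse_exists:
  fixes A :: "real ^ 'n ^ 'n" and B :: "real ^ 'm ^ 'n"
    and C :: "real ^ 'n ^ 'p" and D :: "real ^ 'm ^ 'p"
  assumes ri: "right_invertible A B C D"
    and dc: "dc_point td \<notin> invariant_zeros A B C D"
    and st: "spectrum (A + B ** F) \<subseteq> stab_region td"
  shows "\<exists>G. static_gain td A B C D F ** G = mat 1"
  unfolding matrix_right_invertible_surjective
proof (intro surj_def[THEN iffD2] allI)
  fix y :: "real ^ 'p"
  let ?s = "dc_point td :: complex" and ?M = "A + B ** F" and ?N = "mat (dc_point td) - (A + B ** F)"
  have "rank (pencil A B C D ?s) = CARD('n + 'p)"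
    using dc right_invertible_normal_rank[OF ri] rank_le_rows[of "pencil A B C D ?s"]
    by (simp add: invariant_zeros_def)
  then obtain R :: "complex ^ ('n + 'p) ^ ('n + 'm)" where R: "pencil A B C D ?s ** R = mat 1"
    using full_rank_right_inverse by blast
  define w where "w = R *v (\<chi> i. case i of Inl _ \<Rightarrow> 0 | Inr k \<Rightarrow> complex_of_real (y $ k))"
  have Pw: "pencil A B C D ?s *v w = (\<chi> i. case i of Inl _ \<Rightarrow> 0 | Inr k \<Rightarrow> complex_of_real (y $ k))"
    unfolding w_def matrix_vector_mul_assoc R by simp
  define x where "x = (\<chi> b. Re (w $ Inl b))"
  \<comment> \<open>Real parts solve the equations because the pencil at the dc point is real. The
    solution gives the total input, from which the feedback part is subtracted.\<close>
  define u where "u = (\<chi> c. Re (w $ Inr c)) - F *v x"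
  have Pw_parts: "(pencil A B C D ?s *v w) $ i = (case i of Inl _ \<Rightarrow> 0 | Inr k \<Rightarrow> complex_of_real (y $ k))" for i
    unfolding Pw by simp
  have "(A *v x + B *v (u + F *v x)) $ a = dc_point td * x $ a" for a
  proof -
    have "(pencil A B C D ?s *v w) $ Inl a = (\<Sum>b\<in>UNIV. complex_of_real (A $ a $ b) * w $ Inl b)
        - complex_of_real (dc_point td) * w $ Inl a + (\<Sum>c\<in>UNIV. complex_of_real (B $ a $ c) * w $ Inr c)"
      by (simp add: matrix_vector_mult_def sum_UNIV_Plus pencil_def pencil_over_def
          left_diff_distrib sum_subtractf mult_delta_left of_real_dc_point)
    from arg_cong[OF this, of Re] show ?thesis
      unfolding Pw_parts by (simp add: matrix_vector_mult_def x_def u_def)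
  qed
  then have "A *v x + B *v (u + F *v x) = dc_point td *s x" by (simp add: vec_eq_iff)
  then have "?N *v x = B *v u"
    by (simp add: shifted_matrix_mult_vec matrix_vector_mult_closed_loop
        matrix_vector_right_distrib diff_eq_eq add_ac)
  then have x: "x = matrix_inv ?N *v (B *v u)"
    using matrix_inv_inverse(2)[OF closed_loop_dc_invertible[OF st]]
    by (metis matrix_vector_mul_assoc matrix_vector_mul_lid)
  have "(C *v x + D *v (u + F *v x)) $ k = y $ k" for k
  proof -
    have "(pencil A B C D ?s *v w) $ Inr k = (\<Sum>b\<in>UNIV. complex_of_real (C $ k $ b) * w $ Inl b)
        + (\<Sum>c\<in>UNIV. complex_of_real (D $ k $ c) * w $ Inr c)"
      by (simp add: matrix_vector_mult_def sum_UNIV_Plus pencil_def pencil_over_def)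
    from arg_cong[OF this, of Re] show ?thesis
      unfolding Pw_parts by (simp add: matrix_vector_mult_def x_def u_def)
  qed
  then have y: "y = (C + D ** F) *v x + D *v u"
    by (simp add: vec_eq_iff matrix_vector_mult_closed_loop matrix_vector_right_distrib add_ac)
  have "static_gain td A B C D F *v u = y" unfolding static_gain_mult_vec x[symmetric] y[symmetric] ..
  then show "\<exists>u. y = static_gain td A B C D F *v u" by blast
qed

section \<open>Convergence to the steady state\<close>

lemma scalar_stable_ode_tendsto_zero:
  fixes z :: "real \<Rightarrow> real"
  assumes z: "\<And>t. t \<ge> 0 \<Longrightarrow> (z has_real_derivative a * z t) (at t within {0..})" and a: "a < 0"
  shows "(z \<longlongrightarrow> 0) at_top"
proof -
  \<comment> \<open>Integrating factor: this product is constant, so \<open>z\<close> is a multiple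
    of \<open>exp (a * t)\<close>.\<close>
  have "((\<lambda>t. exp (- a * t) * z t) has_real_derivative 0) (at t within {0..})" if "t \<in> {0..}" for t
    using that by (auto intro!: derivative_eq_intros z simp: algebra_simps)
  then obtain c where c: "\<And>t. t \<in> {0..} \<Longrightarrow> exp (- a * t) * z t = c"
    using has_field_derivative_zero_constant[of "{0..}" "\<lambda>t. exp (- a * t) * z t"]
    by (metis convex_real_interval(1))
  have "z t = c * exp (a * t)" if "t \<ge> 0" for t
  proof -
    have "c * exp (a * t) = exp (- a * t) * exp (a * t) * z t" using c[of t] that by simp
    then show ?thesis by (simp flip: exp_add)
  qed
  then have ev: "eventually (\<lambda>t. c * exp (a * t) = z t) at_top"
    by (auto intro: eventually_mono[OF eventually_ge_at_top[of 0]])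
  have "filterlim (\<lambda>t. a * t) at_bot at_top"
    by (rule filterlim_tendsto_neg_mult_at_bot[OF tendsto_const a filterlim_ident])
  then have "((\<lambda>t. c * exp (a * t)) \<longlongrightarrow> c * 0) at_top"
    by (intro tendsto_mult tendsto_const filterlim_compose[OF exp_at_bot])
  then show ?thesis using Lim_transform_eventually[OF _ ev] by simp
qed

text \<open>The deviation from the steady state \<open>xs r\<close> splits along the eigenbasis into
  scalar equations, each of which decays.\<close>

lemma tracks_constants_of_eigenbasis:
  fixes A :: "real ^ 'n ^ 'n" and B :: "real ^ 'm ^ 'n"
    and C :: "real ^ 'n ^ 'p" and D :: "real ^ 'm ^ 'p"
  assumes S: "independent S" "span S = UNIV"
    and eig: "\<And>b. b \<in> S \<Longrightarrow> (A + B ** F) *v b = lam b *s b"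
    and lam: "\<And>b. b \<in> S \<Longrightarrow> complex_of_real (lam b) \<in> stab_region td"
    and G: "static_gain td A B C D F ** G = mat 1"
  shows "tracks_constants td A B C D F G"
proof -
  let ?M = "A + B ** F" and ?N = "mat (dc_point td) - (A + B ** F)"
  have st: "spectrum ?M \<subseteq> stab_region td"
    using spectrum_on_span_eigenbasis[OF S(1) eig lam] S(2) by simp
  obtain f :: "real ^ 'n \<Rightarrow> real ^ 'n \<Rightarrow> real" where f: "\<And>t. linear (f t)"
    "\<And>t b. t \<in> S \<Longrightarrow> b \<in> S \<Longrightarrow> f t b = (if b = t then 1 else 0)"
    "\<And>w. w \<in> span S \<Longrightarrow> w = (\<Sum>t\<in>S. f t w *\<^sub>R t)"
    using dual_basis_exists[OF S(1)] by blast
  have coord: "f t (?M *v w) = lam t * f t w" if "t \<in> S" for t w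
    by (rule eigenbasis_coordinate[OF f(1) _ eig]) (use that f(2) S(2) in auto)
  define xs where "xs r = matrix_inv ?N *v (B *v (G *v r))" for r :: "real ^ 'p"
  have xs_eq: "?M *v xs r + B *v (G *v r) = dc_point td *s xs r" for r
  proof -
    have "?N *v xs r = B *v (G *v r)"
      unfolding xs_def using matrix_inv_inverse(1)[OF closed_loop_dc_invertible[OF st]]
      by (metis matrix_vector_mul_assoc matrix_vector_mul_lid)
    then show ?thesis by (simp add: shifted_matrix_mult_vec diff_eq_eq add.commute)
  qed
  have ys_eq: "(C + D ** F) *v xs r + D *v (G *v r) = r" for r
  proof -
    have "(C + D ** F) *v xs r + D *v (G *v r) = static_gain td A B C D F *v (G *v r)"
      unfolding static_gain_mult_vec xs_def ..
    then show ?thesis by (simp add: matrix_vector_mul_assoc G)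
  qed
  \<comment> \<open>The last term is zero in continuous time and \<open>xs r\<close> in discrete
    time; in both cases the deviation evolves under the closed-loop map alone.\<close>
  have next_eq: "A *v x + B *v (F *v x + G *v r) = ?M *v (x - xs r) + dc_point td *s xs r" for x r
    unfolding xs_eq[symmetric]
    by (simp add: matrix_vector_mult_add_rdistrib matrix_vector_mul_assoc
        matrix_vector_right_distrib matrix_vector_mult_diff_distrib algebra_simps)
  \<comment> \<open>An arbitrary filter serves both time domains; the feedback law is assumed only
    eventually since continuous time prescribes it just for nonnegative times.\<close>
  have out: "((\<lambda>t. C *v x t + D *v u t) \<longlongrightarrow> r) FF"
    if u: "eventually (\<lambda>t. u t = F *v x t + G *v r) FF"
      and lim: "\<And>b. b \<in> S \<Longrightarrow> ((\<lambda>t. f b (x t - xs r)) \<longlongrightarrow> 0) FF"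
    for x u r and FF :: "'t filter"
  proof -
    have "((\<lambda>t. \<Sum>b\<in>S. f b (x t - xs r) *\<^sub>R b) \<longlongrightarrow> (\<Sum>b\<in>S. 0 *\<^sub>R b)) FF"
      by (intro tendsto_sum tendsto_scaleR tendsto_const lim)
    then have "((\<lambda>t. x t - xs r) \<longlongrightarrow> 0) FF" using f(3)[symmetric] S(2) by simp
    then have "((\<lambda>t. (C + D ** F) *v (x t - xs r)) \<longlongrightarrow> (C + D ** F) *v 0) FF"
      by (rule bounded_linear.tendsto[OF matrix_vector_mul_bounded_linear])
    then have "((\<lambda>t. (C + D ** F) *v (x t - xs r) + r) \<longlongrightarrow> 0 + r) FF"
      by (intro tendsto_add tendsto_const) simp
    moreover have "eventually (\<lambda>t. (C + D ** F) *v (x t - xs r) + r = C *v x t + D *v u t) FF"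
      using u
    proof eventually_elim
      case (elim t)
      have "(C + D ** F) *v (x t - xs r) + r =
          (C + D ** F) *v (x t - xs r) + ((C + D ** F) *v xs r + D *v (G *v r))"
        unfolding ys_eq ..
      then show ?case
        by (simp add: elim matrix_vector_mult_closed_loop matrix_vector_right_distrib
            matrix_vector_mult_diff_distrib)
    qed
    ultimately show ?thesis using Lim_transform_eventually by fastforce
  qed
  show ?thesis
  proof (cases td)
    case Continuous
    show ?thesis
      unfolding Continuous tracks_constants.simps
    proof (intro allI impI, elim conjE, rule out)
      fix r x and u :: "real \<Rightarrow> real ^ 'm"
      assume u: "\<forall>t\<ge>0. u t = F *v x t + G *v r"
        and x: "\<forall>t\<ge>0. (x has_vector_derivative A *v x t + B *v u t) (at t within {0..})"
      show "eventually (\<lambda>t. u t = F *v x t + G *v r) at_top"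
        using eventually_ge_at_top[of 0] by eventually_elim (use u in simp)
      fix b assume b: "b \<in> S"
      show "((\<lambda>t. f b (x t - xs r)) \<longlongrightarrow> 0) at_top"
      proof (rule scalar_stable_ode_tendsto_zero)
        show "lam b < 0" using lam[OF b] Continuous by simp
        fix t :: real assume t: "t \<ge> 0"
        have "A *v x t + B *v u t = ?M *v (x t - xs r)"
          using t u next_eq[of "x t" r] Continuous by simp
        then have "(x has_vector_derivative ?M *v (x t - xs r)) (at t within {0..})"
          using x t by metis
        then have "((\<lambda>t. x t - xs r) has_vector_derivative ?M *v (x t - xs r)) (at t within {0..})"
          by (rule has_vector_derivative_diff[OF _ has_vector_derivative_const, simplified])
        then have "((\<lambda>t. f b (x t - xs r)) has_vector_derivative f b (?M *v (x t - xs r)))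
            (at t within {0..})"
          by (rule bounded_linear.has_vector_derivative[OF linear_conv_bounded_linear[THEN iffD1, OF f(1)]])
        then show "((\<lambda>t. f b (x t - xs r)) has_real_derivative lam b * f b (x t - xs r)) (at t within {0..})"
          by (simp add: coord[OF b] has_real_derivative_iff_has_vector_derivative)
      qed
    qed
  next
    case Discrete
    show ?thesis
      unfolding Discrete tracks_constants.simps
    proof (intro allI impI, elim conjE, rule out)
      fix r x and u :: "nat \<Rightarrow> real ^ 'm"
      assume u: "\<forall>t. u t = F *v x t + G *v r" and x: "\<forall>t. x (Suc t) = A *v x t + B *v u t"
      show "eventually (\<lambda>t. u t = F *v x t + G *v r) sequentially" using u by simp
      fix b assume b: "b \<in> S"
      have step: "f b (x (Suc t) - xs r) = lam b * f b (x t - xs r)" for t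
      proof -
        have "x (Suc t) = ?M *v (x t - xs r) + xs r"
          using x[rule_format, of t] u[rule_format, of t] next_eq[of "x t" r] Discrete by simp
        then show ?thesis by (simp only: add_diff_cancel_right' coord[OF b])
      qed
      obtain c where c: "f b (x 0 - xs r) = c" by blast
      have "f b (x t - xs r) = lam b ^ t * c" for t
        by (induction t) (simp_all only: c step power_0 power_Suc mult_1 mult.assoc)
      moreover have "(\<lambda>t. lam b ^ t * c) \<longlonglongrightarrow> 0 * c"
        using lam[OF b] Discrete by (intro tendsto_mult[OF LIMSEQ_power_zero tendsto_const]) simp
      ultimately show "(\<lambda>t. f b (x t - xs r)) \<longlonglongrightarrow> 0" by simp
    qed
  qed
qed

subsection \<open>Reduction to transversals\<close>

lemma set_sum_member:
  fixes X :: "'i \<Rightarrow> 'a::comm_monoid_add set"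
  assumes "finite P" "i \<in> P" "x \<in> X i" "\<And>k. k \<in> P \<Longrightarrow> 0 \<in> X k"
  shows "x \<in> (\<Sum>i\<in>P. X i)"
proof -
  have "0 \<in> (\<Sum>k\<in>Q. X k)" if "finite Q" "Q \<subseteq> P" for Q
    using that
  proof (induction Q)
    case (insert k Q)
    then have "0 + 0 \<in> X k + (\<Sum>k\<in>Q. X k)" using assms(4) by (intro set_plus_intro) auto
    then show ?case using insert by simp
  qed (simp add: set_zero)
  then have "x + 0 \<in> X i + (\<Sum>k\<in>P - {i}. X k)"
    using assms by (intro set_plus_intro) auto
  then show ?thesis using sum.remove[OF assms(1,2), of X] by simp
qed

lemma set_sum_subset_subspace:
  fixes X :: "'i \<Rightarrow> 'a::real_vector set"
  assumes "finite P" "subspace T" "\<And>i. i \<in> P \<Longrightarrow> X i \<subseteq> T"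
  shows "(\<Sum>i\<in>P. X i) \<subseteq> T"
  using assms(1,3)
proof (induction P)
  case empty
  then show ?case using assms(2) by (simp add: subspace_0 set_zero)
next
  case (insert i P)
  then show ?case using assms(2) by (fastforce elim!: set_plus_elim intro: subspace_add)
qed

text \<open>The outputs in which a mode of class \<open>i\<close> must not appear;
  \<open>None\<close> is the unobservable class.\<close>

definition kept_rows :: "'p option \<Rightarrow> 'p set" where
  "kept_rows i = (case i of None \<Rightarrow> UNIV | Some k \<Rightarrow> UNIV - {k})"

text \<open>
  Transversal members chosen for output \<open>i\<close> may have zero output; they are counted as unobservable.
\<close>

lemma decoupled_modes_of_transversal:
  fixes A :: "real ^ 'n ^ 'n" and B :: "real ^ 'm ^ 'n"
    and C :: "real ^ 'n ^ 'p" and D :: "real ^ 'm ^ 'p" and N :: "'p option \<Rightarrow> nat"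
  defines "I \<equiv> SIGMA i:UNIV. {..<N i}"
  assumes inj: "inj_on e I" and ind: "independent (e ` I)" and sp: "span (e ` I) = UNIV"
    and eig: "\<And>x. x \<in> I \<Longrightarrow> (A + B ** F) *v e x = lam x *s e x"
    and out: "\<And>x k. x \<in> I \<Longrightarrow> k \<in> kept_rows (fst x) \<Longrightarrow> ((C + D ** F) *v e x) $ k = 0"
  shows "\<exists>\<nu> v \<mu>. decoupled_modes A B C D F \<nu> v \<mu> \<and> (\<forall>i. \<nu> (Some i) \<le> N (Some i))"
proof -
  let ?out = "\<lambda>x. (C + D ** F) *v e x"
  define J where "J i = {x \<in> I. i = (if ?out x = 0 then None else fst x)}" for i
  have finI: "finite I" unfolding I_def by (intro finite_SigmaI) auto
  have finJ: "finite (J i)" for i unfolding J_def using finI by simp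
  define \<nu> where "\<nu> i = card (J i)" for i
  have "\<exists>h. bij_betw h {..<\<nu> i} (J i)" for i
    unfolding \<nu>_def using ex_bij_betw_nat_finite[OF finJ] by (simp add: atLeast0LessThan)
  then obtain h where h: "\<And>i. bij_betw (h i) {..<\<nu> i} (J i)" by metis
  have hJ: "h i j \<in> J i" if "j < \<nu> i" for i j
    using h[of i] that by (auto simp: bij_betw_def)
  have hI: "h i j \<in> I" if "j < \<nu> i" for i j
    using hJ[OF that] by (simp add: J_def)
  have h_inj: "inj_on (\<lambda>(i, j). h i j) (SIGMA i:UNIV. {..<\<nu> i})"
  proof (rule inj_onI, clarsimp)
    fix i j i' j' assume a: "j < \<nu> i" "j' < \<nu> i'" "h i j = h i' j'"
    then have "i = i'" using hJ[of j i] hJ[of j' i'] by (auto simp: J_def)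
    then show "i = i' \<and> j = j'" using a h[of i] by (auto simp: bij_betw_def inj_on_def)
  qed
  have h_img: "(\<lambda>(i, j). h i j) ` (SIGMA i:UNIV. {..<\<nu> i}) = I"
  proof (intro subset_antisym subsetI)
    fix x assume "x \<in> I"
    then have "x \<in> J (if ?out x = 0 then None else fst x)" by (simp add: J_def)
    then obtain i j where "j < \<nu> i" "x = h i j" using h by (fastforce simp: bij_betw_def)
    then show "x \<in> (\<lambda>(i, j). h i j) ` (SIGMA i:UNIV. {..<\<nu> i})" by force
  qed (use hI in auto)
  define v where "v i j = e (h i j)" for i j
  have v_comp: "(\<lambda>(i, j). v i j) = e \<circ> (\<lambda>(i, j). h i j)" by (auto simp: v_def)
  have "mode_vectors \<nu> v = e ` I"
    unfolding mode_vectors_def v_comp image_comp[symmetric] h_img ..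
  moreover have "inj_on (\<lambda>(i, j). v i j) (SIGMA i:UNIV. {..<\<nu> i})"
    unfolding v_comp using h_inj h_img inj by (intro comp_inj_on) simp_all
  moreover have "(A + B ** F) *v v i j = lam (h i j) *s v i j" if "j < \<nu> i" for i j
    using eig[OF hI[OF that]] by (simp add: v_def)
  moreover have "(C + D ** F) *v v None j = 0" if j: "j < \<nu> None" for j
  proof (rule ccontr)
    assume ne: "(C + D ** F) *v v None j \<noteq> 0"
    then have "fst (h None j) = None" using hJ[OF j] by (auto simp: J_def v_def)
    then show False using out[OF hI[OF j]] ne by (simp add: kept_rows_def v_def vec_eq_iff)
  qed
  moreover have "\<exists>c. c \<noteq> 0 \<and> (C + D ** F) *v v (Some i) j = c *s axis i 1" if j: "j < \<nu> (Some i)" for i j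
  proof -
    let ?w = "(C + D ** F) *v v (Some i) j"
    have w0: "?w \<noteq> 0" and fst_h: "fst (h (Some i) j) = Some i"
      using hJ[OF j] by (auto simp: J_def v_def split: if_splits)
    have "?w $ k = 0" if "k \<noteq> i" for k
      using out[OF hI[OF j], of k] that fst_h by (simp add: kept_rows_def v_def)
    then have w: "?w = ?w $ i *s axis i 1" by (simp add: vec_eq_iff axis_def)
    then have "?w $ i \<noteq> 0" using w0 by (metis vector_smult_lzero)
    with w show ?thesis by blast
  qed
  moreover have "\<nu> (Some i) \<le> N (Some i)" for i
  proof -
    \<comment> \<open>Regrouping only moves indices out of the class \<open>Some i\<close>, into
      \<open>None\<close>, so the bound persists.\<close>
    have "J (Some i) \<subseteq> Pair (Some i) ` {..<N (Some i)}"
      by (auto simp: J_def I_def split: if_splits)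
    then have "card (J (Some i)) \<le> card (Pair (Some i) ` {..<N (Some i)})"
      by (rule card_mono[rotated]) simp
    also have "\<dots> = N (Some i)" by (simp add: card_image inj_on_def)
    finally show ?thesis by (simp add: \<nu>_def)
  qed
  ultimately have "decoupled_modes A B C D F \<nu> v (\<lambda>i j. lam (h i j)) \<and> (\<forall>i. \<nu> (Some i) \<le> N (Some i))"
    unfolding decoupled_modes_def using ind sp by simp
  then show ?thesis by blast
qed

section \<open>The two directions of the equivalence\<close>

lemma sum_UNIV_option: "(\<Sum>i\<in>UNIV. g i) = g None + (\<Sum>k\<in>UNIV. g (Some k))"
  for g :: "'p::finite option \<Rightarrow> 'a::comm_monoid_add"
  by (simp add: UNIV_option_conv sum.reindex)

lemma mode_set_mono: "mode_set td A B C D UNIV \<subseteq> mode_set td A B C D K"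
  unfolding mode_set_def by blast

text \<open>Each class is represented by as many copies of its mode set as the bounds allow,
  \<open>CARD('n)\<close> in total, so an independent transversal is an eigenbasis. The dimension
  inequalities yield Rado's condition for the copies.\<close>

lemma problem_3C_solvable_if_dimensions:
  fixes A :: "real ^ 'n ^ 'n" and B :: "real ^ 'm ^ 'n"
    and C :: "real ^ 'n ^ 'p" and D :: "real ^ 'm ^ 'p" and td :: time_domain
  defines "E \<equiv> \<lambda>K. mode_set td A B C D K"
  assumes ri: "right_invertible A B C D"
    and dc: "dc_point td \<notin> invariant_zeros A B C D"
    and total: "nubar0 + (\<Sum>i\<in>UNIV. nubar i) = CARD('n)"
    and dims: "\<And>P. (\<Sum>i\<in>P. nubar i) + nubar0 \<le> dim (span (E UNIV) + (\<Sum>i\<in>P. span (E (UNIV - {i}))))"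
  shows "problem_3C_solvable td A B C D nubar"
proof -
  define N where "N i = (case i of None \<Rightarrow> nubar0 | Some k \<Rightarrow> nubar k)" for i
  define I where "I = (SIGMA i:UNIV. {..<N i})"
  have finI: "finite I" unfolding I_def by (intro finite_SigmaI) auto
  have cardI: "card I = CARD('n)"
    unfolding I_def using total by (simp add: card_SigmaI sum_UNIV_option N_def)
  have rado: "card J \<le> dim (\<Union> ((\<lambda>x. E (kept_rows (fst x))) ` J))" if J: "J \<subseteq> I" for J
  proof (cases "J = {}")
    case False
    define P where "P = {k. Some k \<in> fst ` J}"
    let ?T = "span (\<Union> ((\<lambda>x. E (kept_rows (fst x))) ` J))"
    \<comment> \<open>\<open>J\<close> is enlarged to all copies of the outputs it meets and all
      unobservable copies, since the inequalities speak only of such families.\<close>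
    have "J \<subseteq> (SIGMA i:insert None (Some ` P). {..<N i})"
    proof
      fix x assume x: "x \<in> J"
      then show "x \<in> (SIGMA i:insert None (Some ` P). {..<N i})"
        using J by (cases "fst x") (force simp: I_def P_def)+
    qed
    then have "card J \<le> card (SIGMA i:insert None (Some ` P). {..<N i})"
      by (rule card_mono[rotated]) (auto intro: finite_SigmaI)
    also have "\<dots> = (\<Sum>i\<in>P. nubar i) + nubar0"
      by (simp add: card_SigmaI sum.reindex N_def)
    also have "\<dots> \<le> dim (span (E UNIV) + (\<Sum>i\<in>P. span (E (UNIV - {i}))))" by (rule dims)
    also have "\<dots> \<le> dim ?T"
    proof (rule dim_subset)
      \<comment> \<open>The added unobservable copies do not enlarge the span: \<open>J\<close> is
        nonempty, and each of its mode sets contains \<open>E UNIV\<close>.\<close>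
      have "E UNIV \<subseteq> ?T"
      proof -
        obtain x where "x \<in> J" using False by blast
        moreover have "E UNIV \<subseteq> E (kept_rows (fst x))" unfolding E_def by (rule mode_set_mono)
        ultimately have "E UNIV \<subseteq> \<Union> ((\<lambda>x. E (kept_rows (fst x))) ` J)" by blast
        then show ?thesis using span_superset by (rule subset_trans)
      qed
      then have "span (E UNIV) \<subseteq> ?T" by (rule span_minimal) simp
      moreover have "span (E (UNIV - {k})) \<subseteq> ?T" if "k \<in> P" for k
      proof -
        have "Some k \<in> fst ` J" using that by (simp only: P_def mem_Collect_eq)
        then obtain x where x: "x \<in> J" "fst x = Some k" by (elim imageE) metis
        have "E (UNIV - {k}) \<subseteq> \<Union> ((\<lambda>x. E (kept_rows (fst x))) ` J)"
          using UN_upper[OF x(1), of "\<lambda>x. E (kept_rows (fst x))"] x(2)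
          by (simp only: kept_rows_def option.case)
        then have "E (UNIV - {k}) \<subseteq> ?T" using span_superset by (rule subset_trans)
        then show ?thesis by (rule span_minimal) simp
      qed
      then have "(\<Sum>i\<in>P. span (E (UNIV - {i}))) \<subseteq> ?T"
        by (intro set_sum_subset_subspace) auto
      ultimately show "span (E UNIV) + (\<Sum>i\<in>P. span (E (UNIV - {i}))) \<subseteq> ?T"
        by (auto elim!: set_plus_elim intro!: span_add)
    qed
    finally show ?thesis by simp
  qed simp
  obtain e where e: "\<And>x. x \<in> I \<Longrightarrow> e x \<in> E (kept_rows (fst x))" "inj_on e I" "independent (e ` I)"
    using Rado_transversal[OF finI rado] by metis
  have sp: "span (e ` I) = UNIV"
    using card_ge_dim_independent[OF subset_UNIV e(3)] by (simp add: card_image[OF e(2)] cardI top.extremum_unique)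
  have "\<forall>x\<in>I. \<exists>lam u. complex_of_real lam \<in> stab_region td \<and> A *v e x + B *v u = lam *s e x \<and>
     (\<forall>k\<in>kept_rows (fst x). (C *v e x + D *v u) $ k = 0)"
    using e(1) unfolding E_def mode_set_def by blast
  then obtain lam u where lu: "\<And>x. x \<in> I \<Longrightarrow> complex_of_real (lam x) \<in> stab_region td"
    "\<And>x. x \<in> I \<Longrightarrow> A *v e x + B *v u x = lam x *s e x"
    "\<And>x k. x \<in> I \<Longrightarrow> k \<in> kept_rows (fst x) \<Longrightarrow> (C *v e x + D *v u x) $ k = 0"
    by metis
  \<comment> \<open>Inputs and eigenvalues are indexed by copies while the feedback is prescribed on
    vectors; injectivity of \<open>e\<close> recovers the copy.\<close>
  define ix where "ix = inv_into I e"
  have ix: "ix (e x) = x" if "x \<in> I" for x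
    unfolding ix_def by (rule inv_into_f_f[OF e(2) that])
  obtain F :: "real ^ 'n ^ 'm" where "\<forall>b\<in>e ` I. F *v b = u (ix b)"
    using feedback_on_basis_exists[OF e(3), of "\<lambda>b. u (ix b)"] by metis
  then have F: "F *v e x = u x" if "x \<in> I" for x using that ix by simp
  have eig: "(A + B ** F) *v e x = lam x *s e x" if "x \<in> I" for x
    using that by (simp add: matrix_vector_mult_closed_loop F lu(2))
  have eig': "(A + B ** F) *v b = lam (ix b) *s b" "complex_of_real (lam (ix b)) \<in> stab_region td"
    if "b \<in> e ` I" for b using that ix eig lu(1) by auto
  have st: "spectrum (A + B ** F) \<subseteq> stab_region td"
    using spectrum_on_span_eigenbasis[OF e(3) eig'] sp by simp
  obtain G where G: "static_gain td A B C D F ** G = mat 1"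
    using static_gain_right_inverse_exists[OF ri dc st] by blast
  have "tracks_constants td A B C D F G"
    by (rule tracks_constants_of_eigenbasis[OF e(3) sp eig' G])
  moreover have "\<exists>\<nu> v \<mu>. decoupled_modes A B C D F \<nu> v \<mu> \<and> (\<forall>i. \<nu> (Some i) \<le> N (Some i))"
  proof (rule decoupled_modes_of_transversal[where e = e and lam = lam])
    show "((C + D ** F) *v e x) $ k = 0"
      if "x \<in> (SIGMA i:UNIV. {..<N i})" "k \<in> kept_rows (fst x)" for x k
      using lu(3)[of x k] F[of x] that by (simp add: I_def matrix_vector_mult_closed_loop)
  qed (use e sp eig in \<open>auto simp: I_def\<close>)
  ultimately have "solves_problem_3C td A B C D nubar F G"
    using st G by (simp add: solves_problem_3C_def N_def)
  then show ?thesis unfolding problem_3C_solvable_def by blast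
qed

text \<open>The eigenvectors of the unobservable class and of the outputs in \<open>P\<close> are
  independent and lie in the sum of subspaces, so it suffices to count them.\<close>

lemma dimensions_if_problem_3C_solvable:
  fixes A :: "real ^ 'n ^ 'n" and B :: "real ^ 'm ^ 'n"
    and C :: "real ^ 'n ^ 'p" and D :: "real ^ 'm ^ 'p" and td :: time_domain
  defines "E \<equiv> \<lambda>K. mode_set td A B C D K"
  assumes total: "nubar0 + (\<Sum>i\<in>UNIV. nubar i) = CARD('n)"
    and solv: "problem_3C_solvable td A B C D nubar"
  shows "(\<Sum>i\<in>P. nubar i) + nubar0 \<le> dim (span (E UNIV) + (\<Sum>i\<in>P. span (E (UNIV - {i}))))"
proof -
  obtain F \<nu> v \<mu> where st: "spectrum (A + B ** F) \<subseteq> stab_region td"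
    and dec: "decoupled_modes A B C D F \<nu> v \<mu>" and le: "\<And>i. \<nu> (Some i) \<le> nubar i"
    using solv unfolding problem_3C_solvable_def solves_problem_3C_def by blast
  let ?S = "SIGMA i:UNIV. {..<\<nu> i}"
  have inj: "inj_on (\<lambda>(i, j). v i j) ?S" and ind: "independent (mode_vectors \<nu> v)"
    and sp: "span (mode_vectors \<nu> v) = UNIV"
    and eig: "\<And>i j. j < \<nu> i \<Longrightarrow> (A + B ** F) *v v i j = \<mu> i j *s v i j"
    and out0: "\<And>j. j < \<nu> None \<Longrightarrow> (C + D ** F) *v v None j = 0"
    and out: "\<And>i j. j < \<nu> (Some i) \<Longrightarrow> \<exists>c. c \<noteq> 0 \<and> (C + D ** F) *v v (Some i) j = c *s axis i 1"
    using dec unfolding decoupled_modes_def by auto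
  have mem: "v i j \<in> E (kept_rows i)" if j: "j < \<nu> i" for i j
  proof -
    have "v i j \<in> mode_vectors \<nu> v" using j by (force simp: mode_vectors_def)
    then have "v i j \<noteq> 0" using ind dependent_zero by metis
    then have "complex_of_real (\<mu> i j) \<in> stab_region td"
      using real_eigenvalue_in_spectrum[OF eig[OF j]] st by blast
    moreover have "A *v v i j + B *v (F *v v i j) = \<mu> i j *s v i j"
      using eig[OF j] by (simp add: matrix_vector_mult_closed_loop)
    moreover have "(C *v v i j + D *v (F *v v i j)) $ k = 0" if k: "k \<in> kept_rows i" for k
    proof (cases i)
      case None
      then show ?thesis using out0[of j] j by (simp flip: matrix_vector_mult_closed_loop)
    next
      case (Some l)
      then obtain c where "(C + D ** F) *v v i j = c *s axis l 1" using out[of j l] j by auto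
      then show ?thesis
        using k Some by (simp add: kept_rows_def axis_def flip: matrix_vector_mult_closed_loop)
    qed
    ultimately show ?thesis unfolding E_def mode_set_def by blast
  qed
  let ?Q = "SIGMA i:insert None (Some ` P). {..<\<nu> i}"
  have "(\<Sum>i\<in>UNIV. \<nu> i) = card ?S" by (simp add: card_SigmaI)
  also have "\<dots> = card (mode_vectors \<nu> v)"
    unfolding mode_vectors_def using card_image[OF inj] by simp
  also have "\<dots> = CARD('n)"
    using dim_span_eq_card_independent[OF ind] sp by simp
  finally have tot: "\<nu> None + (\<Sum>k\<in>UNIV. \<nu> (Some k)) = nubar0 + (\<Sum>i\<in>UNIV. nubar i)"
    using total by (simp add: sum_UNIV_option)
  have split: "(\<Sum>k\<in>UNIV. g k) = (\<Sum>k\<in>P. g k) + (\<Sum>k\<in>-P. g k)" for g :: "'p \<Rightarrow> nat"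
    using sum.subset_diff[of P UNIV g] by (simp add: Compl_eq_Diff_UNIV add.commute)
  \<comment> \<open>Both totals equal the state dimension, so having no more modes than allowed
    outside \<open>P\<close> forces at least the required number in the remaining classes.\<close>
  have "(\<Sum>k\<in>-P. \<nu> (Some k)) \<le> (\<Sum>k\<in>-P. nubar k)" using le by (intro sum_mono) auto
  then have "(\<Sum>i\<in>P. nubar i) + nubar0 \<le> \<nu> None + (\<Sum>k\<in>P. \<nu> (Some k))"
    using tot split[of nubar] split[of "\<lambda>k. \<nu> (Some k)"] by linarith
  also have "\<dots> = card ?Q" by (simp add: card_SigmaI sum.reindex)
  also have "\<dots> = card ((\<lambda>(i, j). v i j) ` ?Q)"
    by (rule card_image[symmetric]) (rule inj_on_subset[OF inj], auto)
  also have "\<dots> \<le> dim (span (E UNIV) + (\<Sum>i\<in>P. span (E (UNIV - {i}))))"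
  proof (rule independent_card_le_dim)
    show "independent ((\<lambda>(i, j). v i j) ` ?Q)"
      by (rule independent_mono[OF ind]) (auto simp: mode_vectors_def)
    have zero: "0 \<in> (\<Sum>i\<in>P. span (E (UNIV - {i})))"
      using set_sum_member[of P _ 0 "\<lambda>i. span (E (UNIV - {i}))"]
      by (cases "P = {}") (auto simp: span_zero set_zero)
    show "(\<lambda>(i, j). v i j) ` ?Q \<subseteq> span (E UNIV) + (\<Sum>i\<in>P. span (E (UNIV - {i})))"
    proof clarsimp
      fix i j assume i: "i = None \<or> i \<in> Some ` P" and j: "j < \<nu> i"
      show "v i j \<in> span (E UNIV) + (\<Sum>i\<in>P. span (E (UNIV - {i})))"
      proof (cases i)
        case None
        then have "v i j + 0 \<in> span (E UNIV) + (\<Sum>i\<in>P. span (E (UNIV - {i})))"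
          using mem[OF j] zero by (intro set_plus_intro) (auto simp: kept_rows_def intro: span_base)
        then show ?thesis by simp
      next
        case (Some k)
        then have "v i j \<in> span (E (UNIV - {k}))" "k \<in> P"
          using mem[OF j] i by (auto simp: kept_rows_def intro: span_base)
        then have "v i j \<in> (\<Sum>i\<in>P. span (E (UNIV - {i})))"
          by (intro set_sum_member[of P k]) (auto simp: span_zero)
        then have "0 + v i j \<in> span (E UNIV) + (\<Sum>i\<in>P. span (E (UNIV - {i})))"
          by (intro set_plus_intro) (auto simp: span_zero)
        then show ?thesis by simp
      qed
    qed
  qed
  finally show ?thesis .
qed

theorem theorem19:
  fixes td :: time_domain
    and A :: "real ^ 'n ^ 'n" and B :: "real ^ 'm ^ 'n"
    and C :: "real ^ 'n ^ 'p" and D :: "real ^ 'm ^ 'p"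
    and nubar :: "'p \<Rightarrow> nat" and nubar0 :: nat
  assumes "right_invertible A B C D"
    and "stabilizable td A B"
    and "dc_point td \<notin> invariant_zeros A B C D"
    and "\<forall>z \<in> min_phase_zeros td A B C D. zero_alg_mult A B C D z = zero_geom_mult A B C D z"
    and "\<forall>z \<in> min_phase_zeros td A B C D. z \<in> \<real>"
    and "nubar0 + (\<Sum>i\<in>UNIV. nubar i) = CARD('n)"
  shows "problem_3C_solvable td A B C D nubar \<longleftrightarrow>
    (\<forall>P :: 'p set.
       dim (Vg td A B C D + (\<Sum>i\<in>P. Vg_without td A B C D i)) \<ge> (\<Sum>i\<in>P. nubar i) + nubar0)"
  unfolding Vg_def Vg_without_def largest_stab_output_nulling_eq_span[OF assms(1,4,5)]
  using dimensions_if_problem_3C_solvable[OF assms(6), of td A B C D]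
    problem_3C_solvable_if_dimensions[OF assms(1,3,6)]
  by blast

end
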